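(* Let $\alpha^+,\lambda^+,\alpha^-,\lambda^-\in(0,\infty)$ and $\beta^+,\beta^-\in[0,1)$, and let $X\sim\mathrm{TS}(\alpha^+,\beta^+,\lambda^+;\alpha^-,\beta^-,\lambda^-)$ be a tempered stable process. Then, almost surely, $\gamma(X)=\beta(X)=\max\{\beta^+,\beta^-\}$, where $\gamma(X)$ is the $p$-variation index of the sample path of $X$ and $\beta(X)$ is the Blumenthal--Getoor index of $X$.
   Context: For $\alpha^+,\lambda^+,\alpha^-,\lambda^-\in(0,\infty)$ and $\beta^+,\beta^-\in[0,1)$, the tempered stable distribution $\mathrm{TS}(\alpha^+,\beta^+,\lambda^+;\alpha^-,\beta^-,\lambda^-)$ is the infinitely divisible distribution on $\mathbb{R}$ with characteristic function $\varphi(z)=\exp\big(\int_{\mathbb{R}}(e^{izx}-1)F(dx)\big)$, $z\in\mathbb{R}$, where $$F(dx)=\Big(\frac{\alpha^+}{x^{1+\beta^+}}e^{-\lambda^+x}\mathbf{1}_{(0,\infty)}(x)+\frac{\alpha^-}{|x|^{1+\beta^-}}e^{-\lambda^-|x|}\mathbf{1}_{(-\infty,0)}(x)\Big)dx.$$ A tempered stable process $X\sim\mathrm{TS}(\alpha^+,\beta^+,\lambda^+;\alpha^-,\beta^-,\lambda^-)$ is a (càdlàg) Lévy process such that $X_1$ has this distribution; $F$ is its Lévy measure. For $f:\mathbb{R}_+\to\mathbb{R}$ and $p>0$ the $p$-variation is $V_p(f)_t:=\sup\sum_{i=0}^{n-1}|f_{t_{i+1}}-f_{t_i}|^p$, $t\ge0$,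 the supremum running over all decompositions $0=t_0<t_1<\dots<t_n=t$ of $[0,t]$. The $p$-variation index is $\gamma(f):=\inf\{p>0:V_p(f)_t<\infty\text{ for all }t\ge0\}$ (with $\inf\emptyset:=\infty$); $\gamma(X)$ denotes $\omega\mapsto\gamma(X(\omega))$. The Blumenthal--Getoor index of a Lévy process $X$ with Lévy measure $F$ is $\beta(X):=\inf\{p>0:\int_{-1}^1|x|^pF(dx)<\infty\}$. *)

theory Defs
  imports "HOL-Probability.Probability"
begin

section \<open>Levy processes\<close>

definition cadlag :: "(real \<Rightarrow> real) \<Rightarrow> bool" where
  "cadlag f \<longleftrightarrow>
     (\<forall>t\<ge>0. (f \<longlongrightarrow> f t) (at_right t)) \<and>
     (\<forall>t>0. \<exists>l. (f \<longlongrightarrow> l) (at_left t))"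

text \<open>A process is a family indexed by all reals, of which only the times \<open>t \<ge> 0\<close> matter.
  Starting at \<open>0\<close> and the regularity of the paths are only required almost surely.\<close>

locale levy_process = prob_space M for M :: "'a measure" +
  fixes X :: "real \<Rightarrow> 'a \<Rightarrow> real"
  assumes measurable_X: "\<And>t. 0 \<le> t \<Longrightarrow> X t \<in> borel_measurable M"
    and X_zero: "AE \<omega> in M. X 0 \<omega> = 0"
    and independent_increments:
      "\<And>n \<tau>. 0 \<le> \<tau> 0 \<Longrightarrow> (\<And>i. i < n \<Longrightarrow> \<tau> i < \<tau> (Suc i)) \<Longrightarrow>
         indep_vars (\<lambda>_. borel) (\<lambda>i \<omega>. X (\<tau> (Suc i)) \<omega> - X (\<tau> i) \<omega>) {..<n::nat}"
    and stationary_increments: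
      "\<And>s h. 0 \<le> s \<Longrightarrow> 0 \<le> h \<Longrightarrow>
         distr M borel (\<lambda>\<omega>. X (s + h) \<omega> - X s \<omega>) = distr M borel (\<lambda>\<omega>. X h \<omega> - X 0 \<omega>)"
    and stochastically_continuous:
      "\<And>t \<epsilon>. 0 \<le> t \<Longrightarrow> 0 < \<epsilon> \<Longrightarrow>
         ((\<lambda>s. prob {\<omega> \<in> space M. \<bar>X s \<omega> - X t \<omega>\<bar> > \<epsilon>}) \<longlongrightarrow> 0) (at t within {0..})"
    and cadlag_paths: "AE \<omega> in M. cadlag (\<lambda>t. X t \<omega>)"

text \<open>The Levy measure of \<open>X\<close> is the jump measure in the Levy-Khintchine representation of the
  law of \<open>X 1\<close> (with truncation function \<open>x \<mapsto> x 1\<^bsub>[-1,1]\<^esub>(x)\<close>); the choice in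
  \<open>levy_measure\<close> is legitimate since the triplet of a distribution is unique.\<close>

definition levy_khintchine :: "real measure \<Rightarrow> real \<Rightarrow> real \<Rightarrow> real measure \<Rightarrow> bool" where
  "levy_khintchine \<mu> b c F \<longleftrightarrow>
     0 \<le> c \<and> sets F = sets borel \<and> emeasure F {0} = 0 \<and>
     (\<integral>\<^sup>+x. ennreal (min 1 (x\<^sup>2)) \<partial>F) < \<infinity> \<and>
     (\<forall>z. char \<mu> z =
        exp (\<i> * of_real (b * z) - of_real (c * z\<^sup>2 / 2) +
          (CLINT x|F. iexp (z * x) - 1 - \<i> * of_real (z * x * indicator {-1..1} x))))"

definition levy_measure :: "'a measure \<Rightarrow> (real \<Rightarrow> 'a \<Rightarrow> real) \<Rightarrow> real measure" where
  "levy_measure M X = (THE F. \<exists>b c. levy_khintchine (distr M borel (X 1)) b c F)"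

definition blumenthal_getoor_index :: "'a measure \<Rightarrow> (real \<Rightarrow> 'a \<Rightarrow> real) \<Rightarrow> ereal" where
  "blumenthal_getoor_index M X =
     Inf (ereal ` {p. 0 < p \<and> (\<integral>\<^sup>+x\<in>{-1..1}. ennreal (\<bar>x\<bar> powr p) \<partial>levy_measure M X) < \<infinity>})"

section \<open>The \<open>p\<close>-variation index\<close>

text \<open>A decomposition \<open>0 = \<tau>\<^sub>0 < \<dots> < \<tau>\<^sub>n = t\<close> is coded by the pair \<open>(n, \<tau>)\<close>; for \<open>t = 0\<close> the only
  choice is \<open>n = 0\<close>.\<close>

definition p_variation :: "real \<Rightarrow> (real \<Rightarrow> real) \<Rightarrow> real \<Rightarrow> ennreal" where
  "p_variation p f t =
     (SUP (n, \<tau>) \<in> {(n :: nat, \<tau>). \<tau> 0 = 0 \<and> \<tau> n = t \<and> (\<forall>i<n. \<tau> i < \<tau> (Suc i))}.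
        ennreal (\<Sum>i<n. \<bar>f (\<tau> (Suc i)) - f (\<tau> i)\<bar> powr p))"

text \<open>In \<open>ereal\<close> the infimum of the empty set is \<open>\<infinity>\<close>.\<close>

definition p_variation_index :: "(real \<Rightarrow> real) \<Rightarrow> ereal" where
  "p_variation_index f = Inf (ereal ` {p. 0 < p \<and> (\<forall>t\<ge>0. p_variation p f t < \<infinity>)})"

section \<open>Tempered stable distributions and processes\<close>

text \<open>The tempering rates \<open>\<lambda>\<^sup>+\<close>, \<open>\<lambda>\<^sup>-\<close> are called \<open>lp\<close>, \<open>lm\<close>.\<close>

definition ts_measure :: "real \<Rightarrow> real \<Rightarrow> real \<Rightarrow> real \<Rightarrow> real \<Rightarrow> real \<Rightarrow> real measure" where
  "ts_measure \<alpha>p \<beta>p lp \<alpha>m \<beta>m lm =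
     density lborel (\<lambda>x. ennreal (
       \<alpha>p / x powr (1 + \<beta>p) * exp (- lp * x) * indicator {0<..} x +
       \<alpha>m / \<bar>x\<bar> powr (1 + \<beta>m) * exp (- lm * \<bar>x\<bar>) * indicator {..<0} x))"

text \<open>The characteristic function determines the distribution, and its form makes the
  distribution infinitely divisible.\<close>

definition tempered_stable_distribution ::
    "real \<Rightarrow> real \<Rightarrow> real \<Rightarrow> real \<Rightarrow> real \<Rightarrow> real \<Rightarrow> real measure \<Rightarrow> bool" where
  "tempered_stable_distribution \<alpha>p \<beta>p lp \<alpha>m \<beta>m lm \<mu> \<longleftrightarrow>
     real_distribution \<mu> \<and>
     (\<forall>z. char \<mu> z = exp (CLINT x|ts_measure \<alpha>p \<beta>p lp \<alpha>m \<beta>m lm. iexp (z * x) - 1))"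

definition tempered_stable_process ::
    "real \<Rightarrow> real \<Rightarrow> real \<Rightarrow> real \<Rightarrow> real \<Rightarrow> real \<Rightarrow> 'a measure \<Rightarrow> (real \<Rightarrow> 'a \<Rightarrow> real) \<Rightarrow> bool" where
  "tempered_stable_process \<alpha>p \<beta>p lp \<alpha>m \<beta>m lm M X \<longleftrightarrow>
     levy_process M X \<and>
     tempered_stable_distribution \<alpha>p \<beta>p lp \<alpha>m \<beta>m lm (distr M borel (X 1))"

end

(*
  For small p everything reduces to characteristic functions. If 0 < p < 1, subadditivity of
  |x|^p makes the dyadic sums of |increments|^p increase with the level, so by right-continuity
  their limit is the p-variation. The identity
      K |x|^p = integral of (1 - cos (z x)) |z|^(-1-p) dz
  turns E |X_h|^p into an integral of 1 - Re (phi_h z), where phi_h = exp (h psi), and psi is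
  controlled by F; this gives E |X_h|^p <= C h int |x|^p F(dx), so that the expected dyadic sums
  stay bounded whenever int |x|^p F(dx) is finite. Conversely, restricting the same kernel to
  |z| >= 1 and applying Fatou's lemma to (1 - Re (exp (h psi))) / h gives
  E (1 - exp (-|X_h|^q)) / h -> infinity if int_{-1}^1 |x|^q F(dx) = infinity; by independence,
  E exp (- dyadic sum) then tends to 0, and the q-variation is almost surely infinite.

  That F is the Levy measure rests on uniqueness of the triplet: the exponent is determined by
  continuity, and its fourth differences are Fourier transforms of the finite measures
  4 (1 - cos (h x))^2 F(dx).
*)
theory Submission
  imports Defs
begin

text \<open>Everything takes place at exponents below 1, because both stability parameters are below
  1. This is why paths are never split into jumps: for p < 1 the dyadic sums are monotone, and laws
  of single increments suffice. It also makes the absence of drift essential, since a nonzero drift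
  alone has infinite p-variation for every p < 1. An infinite expected variation would not make the
  variation infinite almost surely. The lower bound therefore uses the Laplace transform of the
  dyadic sum, a product over independent increments. This asks for a bounded functional of the
  increment, whereas the full kernel yields the unbounded |y|^q. Cutting it to |z| >= 1 leaves a
  function bounded by a multiple of min 1 (|y|^q), which on |x| <= 1 still dominates a multiple of
  |x|^q. For the triplet, a second difference would keep the Gaussian part as a constant; the fourth
  one removes it. Its kernel with step h vanishes on the multiples of 2 pi / h, so two
  incommensurable steps, 1 and sqrt 2, are combined.\<close>

section \<open>Uniqueness of the Levy measure\<close>

text \<open>The values of g lie in 2 pi i Z, where distinct points are at least 2 pi apart, so
  continuity on the connected line forces g to be constant. This passes from equal characteristic
  functions to equal exponents despite the ambiguity of the complex logarithm.\<close>

lemma continuous_exp_eq_one_imp_zero: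
  fixes g :: "real \<Rightarrow> complex"
  assumes "continuous_on UNIV g" "g 0 = 0" "\<And>z. exp (g z) = 1"
  shows "g z = 0"
proof -
  have "g constant_on UNIV"
  proof (rule continuous_discrete_range_constant[OF connected_UNIV assms(1)])
    fix x :: real
    have "2 * pi \<le> norm (g y - g x)" if "g y \<noteq> g x" for y
    proof -
      obtain m where m: "Re (g y) = 0" "Im (g y) = of_int (2 * m) * pi"
        using assms(3)[of y] unfolding exp_eq_1 by auto
      obtain n where n: "Re (g x) = 0" "Im (g x) = of_int (2 * n) * pi"
        using assms(3)[of x] unfolding exp_eq_1 by auto
      have "Im (g y - g x) = real_of_int (m - n) * (2 * pi)" by (simp add: m n algebra_simps)
      have "m \<noteq> n" using that m n by (auto simp: complex_eq_iff)
      hence "1 \<le> \<bar>real_of_int (m - n)\<bar>" by linarith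
      hence "2 * pi \<le> \<bar>real_of_int (m - n)\<bar> * (2 * pi)" by simp
      also have "\<dots> = \<bar>Im (g y - g x)\<bar>"
        using \<open>Im (g y - g x) = real_of_int (m - n) * (2 * pi)\<close> by (simp add: abs_mult)
      also have "\<dots> \<le> norm (g y - g x)" by (rule abs_Im_le_cmod)
      finally show ?thesis .
    qed
    thus "\<exists>e>0. \<forall>y. y \<in> UNIV \<and> g y \<noteq> g x \<longrightarrow> e \<le> norm (g y - g x)"
      by (intro exI[of _ "2 * pi"]) auto
  qed
  thus ?thesis using assms(2) unfolding constant_on_def by (metis UNIV_I)
qed

text \<open>A continuous function on a connected set with values among the finitely many n-th roots
  of unity is constant. This replaces choosing a branch of the n-th root of a characteristic
  function.\<close>

lemma continuous_root_of_unity_imp_one: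
  fixes g :: "real \<Rightarrow> complex"
  assumes "continuous_on UNIV g" "g 0 = 1" "\<And>z. g z ^ n = 1" "0 < n"
  shows "g z = 1"
proof -
  have "finite (range g)"
    by (rule finite_subset[OF _ finite_roots_unity[of n]]) (use assms in auto)
  hence "g constant_on UNIV"
    by (rule continuous_finite_range_constant[OF connected_UNIV assms(1)])
  thus ?thesis using assms(2) unfolding constant_on_def by (metis UNIV_I)
qed

text \<open>Normalising to probability measures reduces this to \<open>Levy_uniqueness\<close>. The
  transforms at z = 0 are the total masses, hence both measures are divided by the same m; mass zero
  is separate because it cannot be normalised.\<close>

lemma finite_measure_eqI_fourier:
  fixes N N' :: "real measure"
  assumes fin: "finite_measure N" "finite_measure N'"
    and sets [simp]: "sets N = sets borel" "sets N' = sets borel"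
    and char: "\<And>z. (CLINT x|N. iexp (z * x)) = (CLINT x|N'. iexp (z * x))"
  shows "N = N'"
proof -
  interpret N: finite_measure N by fact
  interpret N': finite_measure N' by fact
  have sp: "space N = UNIV" "space N' = UNIV"
    using sets_eq_imp_space_eq[of N borel] sets_eq_imp_space_eq[of N' borel] by auto
  define m where "m = measure N UNIV"
  have m': "measure N' UNIV = m"
    using char[of 0] sp by (simp add: m_def)
  have e: "emeasure N UNIV = ennreal m" "emeasure N' UNIV = ennreal m"
    by (simp_all add: m_def[symmetric] m' N.emeasure_eq_measure N'.emeasure_eq_measure)
  show ?thesis
  proof (cases "m = 0")
    case True
    hence "emeasure N A = 0" "emeasure N' A = 0" for A
      using emeasure_mono[of A UNIV N] emeasure_mono[of A UNIV N'] e by auto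
    thus ?thesis by (intro measure_eqI) auto
  next
    case False
    have m0: "m > 0" using False by (simp add: m_def less_le)
    define c where "c = inverse (ennreal m)"
    have c: "c * ennreal m = 1" "ennreal m * c = 1"
      using m0 by (auto simp: c_def inverse_ennreal divide_simps simp flip: ennreal_mult ennreal_1)
    have "prob_space (scale_measure c N)" "prob_space (scale_measure c N')"
      by (auto intro!: prob_spaceI simp: sp e c space_scale_measure)
    hence rd: "real_distribution (scale_measure c N)" "real_distribution (scale_measure c N')"
      by (auto simp: real_distribution_def real_distribution_axioms_def)
    have ch: "char (scale_measure c K) z = (CLINT x|K. iexp (z * x)) / of_real m"
      if "sets K = sets borel" for K :: "real measure" and z
    proof -
      have "scale_measure c K = density K (\<lambda>x. ennreal (inverse m))"
        by (rule measure_eqI) (use m0 in \<open>auto simp: c_def inverse_ennreal emeasure_density_const\<close>)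
      moreover have "(CLINT x|density K (\<lambda>x. ennreal (inverse m)). iexp (z * x)) =
          (CLINT x|K. of_real (inverse m) * iexp (z * x))"
        using m0 that by (subst integral_density) (auto simp: scaleR_conv_of_real cong: measurable_cong_sets)
      ultimately show ?thesis unfolding char_def
        by (simp only: integral_mult_right_zero) (simp add: divide_inverse)
    qed
    have "scale_measure c N = scale_measure c N'"
      by (rule Levy_uniqueness[OF rd], rule ext) (simp only: ch sets char)
    hence "scale_measure (ennreal m) (scale_measure c N) = scale_measure (ennreal m) (scale_measure c N')"
      by simp
    thus ?thesis by (simp add: scale_scale_measure c)
  qed
qed

section \<open>The Levy-Khintchine exponent and its fourth difference\<close>

definition levy_exponent :: "real \<Rightarrow> real \<Rightarrow> real measure \<Rightarrow> real \<Rightarrow> complex" where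
  "levy_exponent b c F z = \<i> * of_real (b * z) - of_real (c * z\<^sup>2 / 2) +
     (CLINT x|F. iexp (z * x) - 1 - \<i> * of_real (z * x * indicator {-1..1} x))"

text \<open>Inside [-1, 1] the second-order Taylor bound applies, outside the integrand is at most
  2; one constant covers both cases. It stays bounded for bounded z, which gives a dominating
  function for the continuity of the exponent.\<close>

lemma norm_levy_integrand_le:
  "cmod (iexp (z * x) - 1 - \<i> * of_real (z * x * indicator {-1..1} x)) \<le> (2 + z\<^sup>2) * min 1 (x\<^sup>2)"
proof (cases "x \<in> {-1..1}")
  case True
  have "x\<^sup>2 \<le> 1" using True by (simp add: abs_square_le_1 abs_le_iff)
  have "cmod (iexp (z * x) - 1 - \<i> * of_real (z * x)) \<le> (z * x)\<^sup>2 / 2"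
    using iexp_approx1[of "z * x" 1] by (simp add: eval_nat_numeral algebra_simps)
  also have "\<dots> \<le> (2 + z\<^sup>2) * x\<^sup>2"
    by (simp add: power_mult_distrib algebra_simps)
  finally show ?thesis using True \<open>x\<^sup>2 \<le> 1\<close> by (simp add: min_absorb2)
next
  case False
  hence "1 < \<bar>x\<bar>" by auto
  hence "1 \<le> x\<^sup>2" by (metis one_le_power less_imp_le power2_abs)
  have "cmod (iexp (z * x) - 1) \<le> cmod (iexp (z * x)) + cmod 1" by (rule norm_triangle_ineq4)
  also have "\<dots> \<le> 2 + z\<^sup>2" by simp
  finally show ?thesis using False \<open>1 \<le> x\<^sup>2\<close> by simp
qed

lemma measurable_levy_integrand [measurable]:
  "(\<lambda>x::real. iexp (z * x) - 1 - \<i> * of_real (z * x * indicator {-1..1} x)) \<in> borel_measurable borel"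
  by measurable

context
  fixes F :: "real measure"
  assumes sets_F [measurable_cong, simp]: "sets F = sets borel"
    and fin: "(\<integral>\<^sup>+x. ennreal (min 1 (x\<^sup>2)) \<partial>F) < \<infinity>"
begin

lemma integrable_min_square: "integrable F (\<lambda>x. min 1 (x\<^sup>2))"
  by (rule integrableI_nonneg) (use fin in auto)

lemma integrable_levy_integrand:
  "integrable F (\<lambda>x. iexp (z * x) - 1 - \<i> * of_real (z * x * indicator {-1..1} x))"
  by (rule Bochner_Integration.integrable_bound[OF integrable_mult_right[OF integrable_min_square, of "2 + z\<^sup>2"]])
    (use norm_levy_integrand_le in \<open>auto simp: abs_mult\<close>)

lemma continuous_levy_exponent: "continuous_on UNIV (levy_exponent b c F)"
proof -
  have "isCont (levy_exponent b c F) z" for z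
    unfolding continuous_at_sequentially
  proof safe
    fix Y assume Y: "Y \<longlonglongrightarrow> z"
    then obtain B where B: "\<And>n. \<bar>Y n\<bar> \<le> B"
      using convergent_imp_Bseq[OF convergentI[OF Y]] unfolding Bseq_def by auto
    show "(levy_exponent b c F \<circ> Y) \<longlonglongrightarrow> levy_exponent b c F z"
      unfolding comp_def levy_exponent_def
    proof (intro tendsto_intros Y integral_dominated_convergence[where w = "\<lambda>x. (2 + B\<^sup>2) * min 1 (x\<^sup>2)"]
        integrable_mult_right[OF integrable_min_square] AE_I2)
      fix n x
      have "(Y n)\<^sup>2 \<le> B\<^sup>2" using B[of n] power_mono[of "\<bar>Y n\<bar>" B 2] by simp
      hence "(2 + (Y n)\<^sup>2) * min 1 (x\<^sup>2) \<le> (2 + B\<^sup>2) * min 1 (x\<^sup>2)"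
        by (intro mult_right_mono) auto
      thus "cmod (iexp (Y n * x) - 1 - \<i> * of_real (Y n * x * indicator {-1..1} x)) \<le> (2 + B\<^sup>2) * min 1 (x\<^sup>2)"
        using norm_levy_integrand_le[of "Y n" x] by linarith
    qed auto
  qed
  thus ?thesis by (simp add: continuous_at_imp_continuous_on)
qed

text \<open>The fourth difference annihilates the drift and the Gaussian part, and its kernel is
  nonnegative.\<close>

lemma levy_exponent_fourth_difference:
  "levy_exponent b c F (z + 2 * h) - 4 * levy_exponent b c F (z + h) + 6 * levy_exponent b c F z
     - 4 * levy_exponent b c F (z - h) + levy_exponent b c F (z - 2 * h) =
   (CLINT x|F. of_real (4 * (1 - cos (h * x))\<^sup>2) * iexp (z * x))"
proof -
  let ?k = "\<lambda>z x. iexp (z * x) - 1 - \<i> * of_real (z * x * indicator {-1..1} x)"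
  let ?I = "\<lambda>z. (CLINT x|F. ?k z x)"
  have *: "?k (z + 2 * h) x - 4 * ?k (z + h) x + 6 * ?k z x - 4 * ?k (z - h) x + ?k (z - 2 * h) x =
    of_real (4 * (1 - cos (h * x))\<^sup>2) * iexp (z * x)" for x
  proof -
    \<comment> \<open>The coefficients 1, -4, 6, -4, 1 are binomial, so the combination equals a (b
      - 1)^4 / b^2 = a (b + 1/b - 2)^2, and b + 1/b = 2 cos (h x). The constants and the terms
      linear in z cancel.\<close>
    define a b where "a = iexp (z * x)" and "b = iexp (h * x)"
    have b: "b \<noteq> 0" by (simp add: b_def)
    have b2: "b^2 = iexp (2 * (h * x))" by (simp add: b_def mult_ac flip: exp_double)
    have e: "iexp ((z + 2 * h) * x) = a * b^2" "iexp ((z + h) * x) = a * b"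
      "iexp ((z - h) * x) = a / b" "iexp ((z - 2 * h) * x) = a / b^2"
      unfolding b2 by (simp_all add: a_def b_def algebra_simps flip: exp_add exp_diff)
    have c: "complex_of_real (cos (h * x)) = (b + 1 / b) / 2"
      unfolding cos_of_real[symmetric] cos_exp_eq b_def by (simp add: exp_minus inverse_eq_divide)
    have "?k (z + 2 * h) x - 4 * ?k (z + h) x + 6 * ?k z x - 4 * ?k (z - h) x + ?k (z - 2 * h) x =
        a * b\<^sup>2 - 4 * (a * b) + 6 * a - 4 * (a / b) + a / b\<^sup>2"
      by (simp only: e a_def[symmetric]) (simp add: algebra_simps)
    also have "\<dots> = 4 * (1 - (b + 1 / b) / 2)\<^sup>2 * a"
      using b by (simp add: field_simps power2_eq_square)
    also have "\<dots> = of_real (4 * (1 - cos (h * x))\<^sup>2) * iexp (z * x)"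
      by (simp only: c[symmetric] a_def) simp
    finally show ?thesis .
  qed
  have "?I (z + 2 * h) - 4 * ?I (z + h) + 6 * ?I z - 4 * ?I (z - h) + ?I (z - 2 * h) =
    (CLINT x|F. ?k (z + 2 * h) x - 4 * ?k (z + h) x + 6 * ?k z x - 4 * ?k (z - h) x + ?k (z - 2 * h) x)"
    by (simp only: integrable_levy_integrand Bochner_Integration.integral_add Bochner_Integration.integral_diff
        integral_mult_right_zero Bochner_Integration.integrable_diff Bochner_Integration.integrable_add integrable_mult_right)
  also have "\<dots> = (CLINT x|F. of_real (4 * (1 - cos (h * x))\<^sup>2) * iexp (z * x))"
    unfolding * ..
  finally have I: "?I (z + 2 * h) - 4 * ?I (z + h) + 6 * ?I z - 4 * ?I (z - h) + ?I (z - 2 * h) = \<dots>" .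
  show ?thesis unfolding I[symmetric] levy_exponent_def
    by (simp add: field_simps power2_eq_square)
qed

lemma finite_measure_density_cos:
  "finite_measure (density F (\<lambda>x. ennreal (4 * (1 - cos (h * x))\<^sup>2)))"
proof (rule finite_measureI)
  \<comment> \<open>The quantity 1 - cos (h x) is at most 2 and at most |h x|; the squares of these
    bounds serve the two cases of the minimum.\<close>
  have "4 * (1 - cos (h * x))\<^sup>2 \<le> (16 + 4 * h\<^sup>2) * min 1 (x\<^sup>2)" for x
  proof -
    have "\<bar>1 - cos (h * x)\<bar> \<le> 2" using cos_ge_minus_one[of "h * x"] cos_le_one[of "h * x"] by linarith
    hence 1: "(1 - cos (h * x))\<^sup>2 \<le> 4" using power_mono[of "\<bar>1 - cos (h * x)\<bar>" 2 2] by simp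
    have "\<bar>1 - cos (h * x)\<bar> \<le> \<bar>h * x\<bar>"
      using abs_sin_x_le_abs_x[of "h * x / 2"] cos_double_sin[of "h * x / 2"] 
        abs_sin_le_one[of "h * x / 2"] mult_mono[of "\<bar>sin (h * x / 2)\<bar>" 1 "\<bar>sin (h * x / 2)\<bar>" "\<bar>h * x / 2\<bar>"]
      by (simp add: power2_eq_square abs_mult)
    hence 2: "(1 - cos (h * x))\<^sup>2 \<le> h\<^sup>2 * x\<^sup>2"
      using power_mono[of "\<bar>1 - cos (h * x)\<bar>" "\<bar>h * x\<bar>" 2] by (simp add: power_mult_distrib)
    have "0 \<le> h\<^sup>2" "0 \<le> x\<^sup>2" by auto
    show ?thesis
    proof (cases "x\<^sup>2 \<le> 1")
      case True
      have "4 * (1 - cos (h * x))\<^sup>2 \<le> (16 + 4 * h\<^sup>2) * x\<^sup>2"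
        unfolding distrib_right using 2 \<open>0 \<le> x\<^sup>2\<close> by linarith
      thus ?thesis using True by (simp add: min_absorb2)
    next
      case False
      have "4 * (1 - cos (h * x))\<^sup>2 \<le> 16 + 4 * h\<^sup>2" using 1 \<open>0 \<le> h\<^sup>2\<close> by linarith
      thus ?thesis using False by (simp add: min_absorb1)
    qed
  qed
  note bound = this
  have space: "space F = UNIV" using sets_eq_imp_space_eq[OF sets_F] by simp
  have "emeasure (density F (\<lambda>x. ennreal (4 * (1 - cos (h * x))\<^sup>2))) (space F)
    \<le> (\<integral>\<^sup>+x. ennreal ((16 + 4 * h\<^sup>2) * min 1 (x\<^sup>2)) \<partial>F)"
    using bound by (auto simp: emeasure_density space intro!: nn_integral_mono ennreal_leI)
  also have "\<dots> = ennreal (16 + 4 * h\<^sup>2) * (\<integral>\<^sup>+x. ennreal (min 1 (x\<^sup>2)) \<partial>F)"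
    by (simp add: ennreal_mult nn_integral_cmult)
  also have "\<dots> < \<infinity>" using fin by (simp add: ennreal_mult_less_top)
  finally show "emeasure (density F (\<lambda>x. ennreal (4 * (1 - cos (h * x))\<^sup>2)))
     (space (density F (\<lambda>x. ennreal (4 * (1 - cos (h * x))\<^sup>2)))) \<noteq> \<infinity>" by simp
qed

end

lemma levy_khintchine_imp_levy_exponent_eq:
  assumes "levy_khintchine \<mu> b c F" "levy_khintchine \<mu> b' c' F'"
  shows "levy_exponent b c F = levy_exponent b' c' F'"
proof
  fix z
  have cont: "continuous_on UNIV (levy_exponent b c F)" "continuous_on UNIV (levy_exponent b' c' F')"
    using assms by (auto simp: levy_khintchine_def intro!: continuous_levy_exponent)
  have exp: "exp (levy_exponent b c F z) = exp (levy_exponent b' c' F' z)" for z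
    using assms unfolding levy_khintchine_def levy_exponent_def by metis
  define g where "g z = levy_exponent b c F z - levy_exponent b' c' F' z" for z
  have "exp (g z) = 1" for z
    unfolding g_def exp_diff exp[of z] by simp
  moreover have "continuous_on UNIV g" unfolding g_def by (intro continuous_on_diff cont)
  moreover have "g 0 = 0" by (simp add: g_def levy_exponent_def)
  ultimately have "g z = 0" using continuous_exp_eq_one_imp_zero[of g] by blast
  thus "levy_exponent b c F z = levy_exponent b' c' F' z" unfolding g_def by (rule eq_iff_diff_eq_0[THEN iffD2])
qed

text \<open>Otherwise x / (2 pi) and sqrt 2 x / (2 pi) would both be nonzero integers, against the
  irrationality of sqrt 2, which is read off the parity of the exponent of 2 in 2 k^2 = m^2. Thus
  the fourth-difference kernels with steps 1 and sqrt 2 have 0 as their only common zero.\<close>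

lemma cos_and_cos_sqrt2_eq_1:
  assumes "cos x = 1" "cos (sqrt 2 * x) = 1"
  shows "x = 0"
proof (rule ccontr)
  assume x: "x \<noteq> 0"
  obtain k :: int where k: "x = of_int k * 2 * pi" using assms(1) by (auto simp: cos_one_2pi_int)
  obtain m :: int where m: "sqrt 2 * x = of_int m * 2 * pi" using assms(2) by (auto simp: cos_one_2pi_int)
  have k0: "k \<noteq> 0" using x k by auto
  have "sqrt 2 * of_int k = of_int m" using k m by simp
  hence "(sqrt 2 * of_int k)\<^sup>2 = (of_int m)\<^sup>2" by simp
  hence "of_int (2 * k\<^sup>2) = (of_int (m\<^sup>2) :: real)" by (simp add: power_mult_distrib)
  hence eq: "2 * k\<^sup>2 = m\<^sup>2" by linarith
  hence m0: "m \<noteq> 0" using k0 by auto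
  have "multiplicity 2 (2 * k\<^sup>2) = 1 + 2 * multiplicity 2 k"
    using k0 by (simp add: prime_elem_multiplicity_mult_distrib prime_elem_multiplicity_power_distrib)
  moreover have "multiplicity 2 (m\<^sup>2) = 2 * multiplicity 2 m"
    using m0 by (simp add: prime_elem_multiplicity_power_distrib)
  ultimately have "1 + 2 * multiplicity 2 k = 2 * multiplicity 2 m" using eq by simp
  thus False by presburger
qed

theorem levy_khintchine_unique:
  assumes LK: "levy_khintchine \<mu> b c F" and LK': "levy_khintchine \<mu> b' c' F'"
  shows "F = F'"
proof -
  have F [measurable_cong, simp]: "sets F = sets borel" "sets F' = sets borel"
    and F0: "emeasure F {0} = 0" "emeasure F' {0} = 0"
    and fin: "(\<integral>\<^sup>+x. ennreal (min 1 (x\<^sup>2)) \<partial>F) < \<infinity>" "(\<integral>\<^sup>+x. ennreal (min 1 (x\<^sup>2)) \<partial>F') < \<infinity>"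
    using assms by (auto simp: levy_khintchine_def)
  define u where "u h x = 4 * (1 - cos (h * x))\<^sup>2" for h x :: real
  have [measurable]: "u h \<in> borel_measurable borel" for h unfolding u_def by measurable
  have u0: "0 \<le> u h x" for h x by (simp add: u_def)
  have dens: "density F (\<lambda>x. ennreal (u h x)) = density F' (\<lambda>x. ennreal (u h x))" for h
  proof (rule finite_measure_eqI_fourier)
    fix z
    have *: "(CLINT x|density G (\<lambda>x. ennreal (u h x)). iexp (z * x)) =
      (CLINT x|G. of_real (4 * (1 - cos (h * x))\<^sup>2) * iexp (z * x))" if [measurable_cong]: "sets G = sets borel" for G
      by (subst integral_density) (auto simp: u0 scaleR_conv_of_real, simp add: u_def)
    show "(CLINT x|density F (\<lambda>x. ennreal (u h x)). iexp (z * x)) =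
      (CLINT x|density F' (\<lambda>x. ennreal (u h x)). iexp (z * x))"
      unfolding *[OF F(1)] *[OF F(2)]
        levy_exponent_fourth_difference[OF F(1) fin(1), of b c, symmetric]
        levy_exponent_fourth_difference[OF F(2) fin(2), of b' c', symmetric]
        levy_khintchine_imp_levy_exponent_eq[OF LK LK'] ..
  qed (use finite_measure_density_cos F fin in \<open>auto simp: u_def\<close>)
  \<comment> \<open>A single kernel such as \<open>u 1\<close> vanishes at nonzero points and cannot
    be divided out; the sum is positive off 0.\<close>
  define v where "v x = ennreal (u 1 x) + ennreal (u (sqrt 2) x)" for x
  have [measurable]: "v \<in> borel_measurable borel" unfolding v_def by measurable
  have v: "v x \<noteq> 0" if "x \<noteq> 0" for x
    using cos_and_cos_sqrt2_eq_1[of x] that by (auto simp: v_def u_def)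
  have dens_v: "density F v = density F' v"
  proof (rule measure_eqI)
    fix A assume "A \<in> sets (density F v)"
    hence [measurable]: "A \<in> sets borel" by simp
    have *: "emeasure (density G v) A = emeasure (density G (\<lambda>x. ennreal (u 1 x))) A +
      emeasure (density G (\<lambda>x. ennreal (u (sqrt 2) x))) A" if [measurable_cong, simp]: "sets G = sets borel" for G
      by (simp add: emeasure_density v_def distrib_right nn_integral_add)
    show "emeasure (density F v) A = emeasure (density F' v) A"
      unfolding *[OF F(1)] *[OF F(2)] dens ..
  qed simp
  have vv: "v x * inverse (v x) = 1" if "x \<noteq> 0" for x
    unfolding divide_ennreal_def[symmetric]
    by (rule ennreal_divide_self[OF v[OF that]]) (simp add: v_def less_top[symmetric])
  \<comment> \<open>Dividing by \<open>v\<close> recovers the measure off 0; at 0, where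
    \<open>v\<close> vanishes, the convention that a Levy measure has no mass there takes
    over.\<close>
  have inv: "density (density G v) (\<lambda>x. inverse (v x)) = G"
    if [measurable_cong, simp]: "sets G = sets borel" and G0: "emeasure G {0} = 0" for G
  proof -
    have "AE x in G. x \<noteq> 0" by (rule AE_I[of _ _ "{0}"]) (auto simp: G0)
    hence "AE x in G. v x * inverse (v x) = 1"
      by eventually_elim (rule vv)
    hence "density G (\<lambda>x. v x * inverse (v x)) = density G (\<lambda>_. 1)"
      by (intro density_cong) auto
    thus ?thesis by (simp add: density_density_eq density_1)
  qed
  show ?thesis using inv[OF F(1) F0(1)] inv[OF F(2) F0(2)] unfolding dens_v by (rule trans[OF sym])
qed

corollary levy_measure_eqI:
  assumes "levy_khintchine (distr M borel (X 1)) b c F"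
  shows "levy_measure M X = F"
  unfolding levy_measure_def
proof (rule the_equality)
  show "\<exists>b c. levy_khintchine (distr M borel (X 1)) b c F" using assms by blast
next
  fix F' assume "\<exists>b c. levy_khintchine (distr M borel (X 1)) b c F'"
  thus "F' = F" using assms by (auto intro: levy_khintchine_unique)
qed

section \<open>Integrals against power kernels\<close>

lemma nn_integral_lborel_split_sign:
  fixes f :: "real \<Rightarrow> ennreal"
  assumes [measurable]: "f \<in> borel_measurable borel"
  shows "(\<integral>\<^sup>+x. f x \<partial>lborel) = (\<integral>\<^sup>+x\<in>{0<..}. f x \<partial>lborel) + (\<integral>\<^sup>+x\<in>{0<..}. f (- x) \<partial>lborel)"
proof -
  have "AE x in lborel. x \<noteq> (0::real)" by (rule AE_lborel_singleton)
  hence "(\<integral>\<^sup>+x. f x \<partial>lborel) = (\<integral>\<^sup>+x. f x * indicator {0<..} x + f x * indicator {..<0} x \<partial>lborel)"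
    by (intro nn_integral_cong_AE, eventually_elim) (auto simp: indicator_def)
  also have "\<dots> = (\<integral>\<^sup>+x\<in>{0<..}. f x \<partial>lborel) + (\<integral>\<^sup>+x\<in>{..<0}. f x \<partial>lborel)"
    by (rule nn_integral_add) auto
  also have "(\<integral>\<^sup>+x\<in>{..<0}. f x \<partial>lborel) = (\<integral>\<^sup>+x. f (- x) * indicator {..<0} (- x) \<partial>lborel)"
    by (subst nn_integral_real_affine[of _ "-1" 0]) auto
  also have "\<dots> = (\<integral>\<^sup>+x\<in>{0<..}. f (- x) \<partial>lborel)"
    by (intro nn_integral_cong) (auto simp: indicator_def)
  finally show ?thesis .
qed

lemma nn_integral_powr_0_1:
  fixes a :: real
  assumes "- 1 < a"
  shows "(\<integral>\<^sup>+x\<in>{0<..1}. ennreal (x powr a) \<partial>lborel) < \<infinity>"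
proof -
  have "((\<lambda>x. if x \<in> {0..1} then x powr a else 0) has_integral (1 powr (a + 1) / (a + 1))) UNIV"
    using has_integral_powr_from_0[OF assms, of 1] by (subst has_integral_restrict_UNIV) auto
  hence "(\<integral>\<^sup>+x. ennreal (if x \<in> {0..1} then x powr a else 0) \<partial>lborel) = ennreal (1 powr (a + 1) / (a + 1))"
    by (intro nn_integral_has_integral_lborel) auto
  hence "(\<integral>\<^sup>+x. ennreal (if x \<in> {0..1} then x powr a else 0) \<partial>lborel) < \<infinity>" by simp
  moreover have "(\<integral>\<^sup>+x\<in>{0<..1}. ennreal (x powr a) \<partial>lborel) \<le>
      (\<integral>\<^sup>+x. ennreal (if x \<in> {0..1} then x powr a else 0) \<partial>lborel)"
    by (intro nn_integral_mono) (auto simp: indicator_def)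
  ultimately show ?thesis by (rule le_less_trans[rotated])
qed

lemma nn_integral_powr_0_1_infinite:
  fixes a :: real
  assumes "a \<le> - 1"
  shows "(\<integral>\<^sup>+x\<in>{0<..1}. ennreal (x powr a) \<partial>lborel) = \<infinity>"
proof -
  have "of_nat n \<le> (\<integral>\<^sup>+x\<in>{0<..1}. ennreal (x powr a) \<partial>lborel)" for n :: nat
  proof -
    \<comment> \<open>The integral of 1 / x over [exp (- n), 1] is exactly n, and on (0, 1] the
      given power dominates 1 / x.\<close>
    define e where "e = exp (- real n)"
    have e: "0 < e" "e \<le> 1" by (auto simp: e_def)
    have "(\<integral>\<^sup>+x. ennreal (if 0 < x then 1 / x else 0) * indicator {e..1} x \<partial>lborel) = ennreal (ln 1 - ln e)"
      by (rule nn_integral_FTC_Icc) (use e in \<open>auto intro!: derivative_eq_intros\<close>)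
    also have "ln 1 - ln e = real n" by (simp add: e_def)
    finally have "of_nat n = (\<integral>\<^sup>+x. ennreal (if 0 < x then 1 / x else 0) * indicator {e..1} x \<partial>lborel)"
      by (simp add: ennreal_of_nat_eq_real_of_nat)
    also have "\<dots> \<le> (\<integral>\<^sup>+x\<in>{0<..1}. ennreal (x powr a) \<partial>lborel)"
    proof (intro nn_integral_mono)
      fix x :: real
      have "1 / x \<le> x powr a" if "0 < x" "x \<le> 1"
        using that powr_mono'[of a "-1" x] assms by (simp add: powr_minus divide_inverse)
      thus "ennreal (if 0 < x then 1 / x else 0) * indicator {e..1} x \<le> ennreal (x powr a) * indicator {0<..1} x"
        using e by (auto simp: indicator_def intro!: ennreal_leI)
    qed
    finally show ?thesis .
  qed
  thus ?thesis by (metis ennreal_Ex_less_of_nat infinity_ennreal_def linorder_not_less top.not_eq_extremum)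
qed

lemma nn_integral_powr_1_inf:
  fixes a :: real
  assumes "a < - 1"
  shows "(\<integral>\<^sup>+x\<in>{1..}. ennreal (x powr a) \<partial>lborel) < \<infinity>"
proof -
  have "((\<lambda>x. if x \<in> {1..} then x powr a else 0) has_integral (- (1 powr (a + 1)) / (a + 1))) UNIV"
    using has_integral_powr_to_inf[OF assms, of 1] by (subst has_integral_restrict_UNIV) auto
  hence "(\<integral>\<^sup>+x. ennreal (if x \<in> {1..} then x powr a else 0) \<partial>lborel) = ennreal (- (1 powr (a + 1)) / (a + 1))"
    by (intro nn_integral_has_integral_lborel) auto
  also have "(\<integral>\<^sup>+x. ennreal (if x \<in> {1..} then x powr a else 0) \<partial>lborel) = 
    (\<integral>\<^sup>+x\<in>{1..}. ennreal (x powr a) \<partial>lborel)"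
    by (intro nn_integral_cong) (auto simp: indicator_def)
  finally show ?thesis by simp
qed

text \<open>Substitute u = z x: the weight is homogeneous of degree - 1 - p, so a factor |x|^p comes
  out, and its evenness covers negative x. The condition f 0 = 0 settles x = 0. All kernel
  identities below are instances, with f equal to 1 - cos, to min 2 |u|, or to 1 - cos cut to |u| >=
  1.\<close>

lemma nn_integral_powr_scale:
  fixes f :: "real \<Rightarrow> real"
  assumes [measurable]: "f \<in> borel_measurable borel" and nn: "\<And>u. 0 \<le> f u" and f0: "f 0 = 0"
  shows "(\<integral>\<^sup>+z. ennreal (f (z * x) * \<bar>z\<bar> powr (- 1 - p)) \<partial>lborel) =
    ennreal (\<bar>x\<bar> powr p) * (\<integral>\<^sup>+z. ennreal (f z * \<bar>z\<bar> powr (- 1 - p)) \<partial>lborel)"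
proof (cases "x = 0")
  case True
  thus ?thesis by (simp add: f0)
next
  case False
  have "(\<integral>\<^sup>+z. ennreal (f (z * x) * \<bar>z\<bar> powr (- 1 - p)) \<partial>lborel) =
    ennreal \<bar>1 / x\<bar> * (\<integral>\<^sup>+u. ennreal (f (1 / x * u * x) * \<bar>1 / x * u\<bar> powr (- 1 - p)) \<partial>lborel)"
    by (subst nn_integral_real_affine[where c = "1 / x" and t = 0]) (use False in auto)
  also have "\<dots> = ennreal \<bar>1 / x\<bar> * (\<integral>\<^sup>+u. ennreal (\<bar>x\<bar> powr (1 + p)) * ennreal (f u * \<bar>u\<bar> powr (- 1 - p)) \<partial>lborel)"
  proof (intro arg_cong[of _ _ "\<lambda>I. ennreal \<bar>1 / x\<bar> * I"] nn_integral_cong)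
    fix u :: real
    have "\<bar>1 / x * u\<bar> powr (- 1 - p) = \<bar>x\<bar> powr (1 + p) * \<bar>u\<bar> powr (- 1 - p)"
      using False by (simp add: abs_mult abs_divide powr_mult powr_divide powr_minus_divide[of _ "1 + p", simplified])
    thus "ennreal (f (1 / x * u * x) * \<bar>1 / x * u\<bar> powr (- 1 - p)) =
       ennreal (\<bar>x\<bar> powr (1 + p)) * ennreal (f u * \<bar>u\<bar> powr (- 1 - p))"
      using False by (simp add: nn mult_ac flip: ennreal_mult')
  qed
  also have "\<dots> = ennreal (\<bar>1 / x\<bar> * \<bar>x\<bar> powr (1 + p)) * (\<integral>\<^sup>+z. ennreal (f z * \<bar>z\<bar> powr (- 1 - p)) \<partial>lborel)"
    by (subst nn_integral_cmult) (simp_all add: ennreal_mult mult.assoc del: abs_divide)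
  also have "\<bar>1 / x\<bar> * \<bar>x\<bar> powr (1 + p) = \<bar>x\<bar> powr p"
    using False by (simp add: powr_add)
  finally show ?thesis .
qed

text \<open>Near 0 the integrand is |z|^(-p), integrable because p < 1; at infinity it is of order
  |z|^(-1-p), integrable because p > 0.\<close>

lemma nn_integral_min_powr_finite:
  fixes p :: real
  assumes "0 < p" "p < 1"
  shows "(\<integral>\<^sup>+z. ennreal (min 2 \<bar>z\<bar> * \<bar>z\<bar> powr (- 1 - p)) \<partial>lborel) < \<infinity>"
proof -
  let ?f = "\<lambda>z. ennreal (min 2 \<bar>z\<bar> * \<bar>z\<bar> powr (- 1 - p))"
  have "(\<integral>\<^sup>+z\<in>{0<..}. ?f z \<partial>lborel) \<le>
    (\<integral>\<^sup>+z. ennreal (z powr (- p)) * indicator {0<..1} z + 2 * (ennreal (z powr (- 1 - p)) * indicator {1..} z) \<partial>lborel)"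
  proof (intro nn_integral_mono)
    fix z :: real
    have "min 2 \<bar>z\<bar> * \<bar>z\<bar> powr (- 1 - p) \<le> z powr (- p)" if "0 < z" "z \<le> 1"
    proof -
      have "z powr (- p) = z * z powr (- 1 - p)"
        using that powr_add[of z 1 "- 1 - p"] by simp
      thus ?thesis using that by simp
    qed
    moreover have "ennreal (min 2 \<bar>z\<bar> * \<bar>z\<bar> powr (- 1 - p)) \<le> 2 * ennreal (z powr (- 1 - p))" if "1 < z"
    proof -
      have "min 2 \<bar>z\<bar> * \<bar>z\<bar> powr (- 1 - p) \<le> 2 * z powr (- 1 - p)"
        using that by (auto intro!: mult_mono)
      hence "ennreal (min 2 \<bar>z\<bar> * \<bar>z\<bar> powr (- 1 - p)) \<le> ennreal (2 * z powr (- 1 - p))" by (rule ennreal_leI)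
      thus ?thesis by (simp add: ennreal_mult)
    qed
    ultimately show "?f z * indicator {0<..} z \<le>
       ennreal (z powr (- p)) * indicator {0<..1} z + 2 * (ennreal (z powr (- 1 - p)) * indicator {1..} z)"
      by (cases "z \<le> 1") (auto simp: indicator_def intro!: ennreal_leI order_trans[OF _ add_increasing2])
  qed
  also have "\<dots> = (\<integral>\<^sup>+z\<in>{0<..1}. ennreal (z powr (- p)) \<partial>lborel) + 2 * (\<integral>\<^sup>+z\<in>{1..}. ennreal (z powr (- 1 - p)) \<partial>lborel)"
    by (subst nn_integral_add) (auto simp: nn_integral_cmult)
  also have "\<dots> < \<infinity>"
    using nn_integral_powr_0_1[of "- p"] nn_integral_powr_1_inf[of "- 1 - p"] assms
    by (auto simp: ennreal_mult_less_top)
  finally have "(\<integral>\<^sup>+z\<in>{0<..}. ?f z \<partial>lborel) < \<infinity>" .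
  thus ?thesis by (subst nn_integral_lborel_split_sign) auto
qed

text \<open>On [1, 2], inside [0, pi], the cosine is at most cos 1 < 1, so the integrand has a
  positive lower bound there. The restriction to |z| >= 1 is the one used for infinite variation;
  enlarging the domain yields positivity of the full constant too.\<close>

lemma nn_integral_one_minus_cos_powr_pos:
  fixes p :: real
  assumes "0 < p"
  shows "0 < (\<integral>\<^sup>+z\<in>{z. 1 \<le> \<bar>z\<bar>}. ennreal ((1 - cos z) * \<bar>z\<bar> powr (- 1 - p)) \<partial>lborel)"
proof -
  have "cos 1 < cos (0::real)" by (rule cos_monotone_0_pi) (use pi_gt3 in auto)
  hence c: "0 < (1 - cos 1) * 2 powr (- 1 - p)" by simp
  hence "0 < (\<integral>\<^sup>+z. ennreal ((1 - cos 1) * 2 powr (- 1 - p)) * indicator {1..2} z \<partial>(lborel::real measure))"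
    by (subst nn_integral_cmult_indicator) auto
  also have "\<dots> \<le> (\<integral>\<^sup>+z\<in>{z. 1 \<le> \<bar>z\<bar>}. ennreal ((1 - cos z) * \<bar>z\<bar> powr (- 1 - p)) \<partial>lborel)"
  proof (intro nn_integral_mono)
    fix z :: real
    have "(1 - cos 1) * 2 powr (- 1 - p) \<le> (1 - cos z) * \<bar>z\<bar> powr (- 1 - p)" if "1 \<le> z" "z \<le> 2"
    proof (intro mult_mono)
      show "1 - cos 1 \<le> 1 - cos z"
        using that cos_monotone_0_pi_le[of 1 z] pi_gt3 by auto
      show "2 powr (- 1 - p) \<le> \<bar>z\<bar> powr (- 1 - p)"
        using that assms by (intro powr_mono2') auto
    qed auto
    thus "ennreal ((1 - cos 1) * 2 powr (- 1 - p)) * indicator {1..2} z \<le>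
        ennreal ((1 - cos z) * \<bar>z\<bar> powr (- 1 - p)) * indicator {z. 1 \<le> \<bar>z\<bar>} z"
      by (auto simp: indicator_def intro!: ennreal_leI)
  qed
  finally show ?thesis .
qed

section \<open>Bounds for oscillating and exponential integrands\<close>

lemma norm_iexp_minus_one_le: "cmod (iexp u - 1) \<le> min 2 \<bar>u\<bar>"
  using iexp_approx1[of u 0] iexp_approx2[of u 0] by simp

lemma one_minus_cos_le: "1 - cos u \<le> min 2 \<bar>u\<bar>" for u :: real
proof -
  have "1 - cos u \<le> cmod (iexp u - 1)"
    using abs_Re_le_cmod[of "iexp u - 1"] by (simp add: Re_exp)
  thus ?thesis using norm_iexp_minus_one_le[of u] by linarith
qed

text \<open>From exp t >= 1 + t one gets 1 - exp (- t) >= t / (1 + t). It turns a bound by min 1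
  (|y|^q) into one by 1 - exp (- |y|^q), whose mean governs the Laplace transform.\<close>

lemma one_minus_exp_neg_ge: "min 1 t / 2 \<le> 1 - exp (- t)" if "0 \<le> t" for t :: real
proof -
  have "exp (- t) \<le> 1 / (1 + t)"
    using that exp_ge_add_one_self[of t] by (simp add: exp_minus divide_simps)
  moreover have "min 1 t / 2 \<le> 1 - 1 / (1 + t)"
  proof (cases "t \<le> 1")
    case True
    have "t * t \<le> t * 1" using True that by (intro mult_left_mono) auto
    thus ?thesis using that True by (simp add: field_simps min_absorb2)
  next
    case False thus ?thesis by (simp add: field_simps)
  qed
  ultimately show ?thesis by linarith
qed

section \<open>Levy measures of finite variation\<close>

text \<open>Leaving out the compensator fixes the drift at zero; this is the form in which the
  tempered stable distribution is given.\<close>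

definition fv_exponent :: "real measure \<Rightarrow> real \<Rightarrow> complex" where
  "fv_exponent F z = (CLINT x|F. iexp (z * x) - 1)"

locale fv_levy_measure = sigma_finite_measure F for F :: "real measure" +
  assumes sets_F [measurable_cong, simp]: "sets F = sets borel"
    and finite_variation: "(\<integral>\<^sup>+x. ennreal (min 1 \<bar>x\<bar>) \<partial>F) < \<infinity>"
begin

lemma integrable_min_1_abs: "integrable F (\<lambda>x. min 1 \<bar>x\<bar>)"
  by (rule integrableI_nonneg) (use finite_variation in auto)

lemma norm_iexp_minus_one_le_min_1: "cmod (iexp (z * x) - 1) \<le> (2 + \<bar>z\<bar>) * min 1 \<bar>x\<bar>"
proof (cases "\<bar>x\<bar> \<le> 1")
  case True
  have "cmod (iexp (z * x) - 1) \<le> \<bar>z\<bar> * \<bar>x\<bar>"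
    using norm_iexp_minus_one_le[of "z * x"] by (simp add: abs_mult)
  also have "\<dots> \<le> (2 + \<bar>z\<bar>) * \<bar>x\<bar>" by (intro mult_right_mono) auto
  finally show ?thesis using True by (simp add: min_absorb2)
next
  case False
  moreover have "cmod (iexp (z * x) - 1) \<le> 2" using norm_iexp_minus_one_le[of "z * x"] by simp
  ultimately show ?thesis using abs_ge_zero[of z] by (simp add: min_absorb1 del: abs_ge_zero)
qed

lemma integrable_iexp_minus_one: "integrable F (\<lambda>x. iexp (z * x) - 1)"
  by (rule Bochner_Integration.integrable_bound[OF integrable_mult_right[OF integrable_min_1_abs, of "2 + \<bar>z\<bar>"]])
    (use norm_iexp_minus_one_le_min_1 in \<open>auto simp: abs_mult\<close>)

lemma fv_exponent_0: "fv_exponent F 0 = 0"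
  by (simp add: fv_exponent_def)

lemma isCont_fv_exponent: "isCont (fv_exponent F) z"
  unfolding continuous_at_sequentially
proof safe
  fix Y assume Y: "Y \<longlonglongrightarrow> z"
  then obtain B where B: "\<And>n. \<bar>Y n\<bar> \<le> B"
    using convergent_imp_Bseq[OF convergentI[OF Y]] unfolding Bseq_def by auto
  show "(fv_exponent F \<circ> Y) \<longlonglongrightarrow> fv_exponent F z"
    unfolding comp_def fv_exponent_def
  proof (rule integral_dominated_convergence[where w = "\<lambda>x. (2 + B) * min 1 \<bar>x\<bar>"])
    show "integrable F (\<lambda>x. (2 + B) * min 1 \<bar>x\<bar>)"
      by (intro integrable_mult_right integrable_min_1_abs)
    show "AE x in F. (\<lambda>n. iexp (Y n * x) - 1) \<longlonglongrightarrow> iexp (z * x) - 1"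
      by (intro AE_I2 tendsto_intros Y)
    have "cmod (iexp (Y n * x) - 1) \<le> (2 + B) * min 1 \<bar>x\<bar>" for n x
    proof -
      have "(2 + \<bar>Y n\<bar>) * min 1 \<bar>x\<bar> \<le> (2 + B) * min 1 \<bar>x\<bar>"
        using B[of n] by (intro mult_right_mono) auto
      thus ?thesis using norm_iexp_minus_one_le_min_1[of "Y n" x] by linarith
    qed
    thus "AE x in F. cmod (iexp (Y n * x) - 1) \<le> (2 + B) * min 1 \<bar>x\<bar>" for n by simp
  qed auto
qed

lemma measurable_fv_exponent [measurable]: "fv_exponent F \<in> borel_measurable borel"
  by (auto intro!: borel_measurable_continuous_onI continuous_at_imp_continuous_on isCont_fv_exponent)

lemma minus_Re_fv_exponent: "- Re (fv_exponent F z) = (\<integral>x. 1 - cos (z * x) \<partial>F)"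
  unfolding fv_exponent_def
  by (subst integral_Re[OF integrable_iexp_minus_one, symmetric], subst Bochner_Integration.integral_minus[symmetric])
    (simp add: Re_exp)

lemma ennreal_minus_Re_fv_exponent:
  "ennreal (- Re (fv_exponent F z)) = (\<integral>\<^sup>+x. ennreal (1 - cos (z * x)) \<partial>F)"
proof -
  have "- Re (fv_exponent F z) = (\<integral>x. 1 - cos (z * x) \<partial>F)" by (rule minus_Re_fv_exponent)
  also have "ennreal \<dots> = (\<integral>\<^sup>+x. ennreal (1 - cos (z * x)) \<partial>F)"
  proof (rule nn_integral_eq_integral[symmetric])
    have "integrable F (\<lambda>x. - Re (iexp (z * x) - 1))"
      by (intro Bochner_Integration.integrable_minus integrable_Re integrable_iexp_minus_one)
    thus "integrable F (\<lambda>x. 1 - cos (z * x))" by (simp add: Re_exp)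
  qed auto
  finally show ?thesis .
qed

lemma Re_fv_exponent_le_0: "Re (fv_exponent F z) \<le> 0"
proof -
  have "- Re (fv_exponent F z) = (\<integral>x. 1 - cos (z * x) \<partial>F)" by (rule minus_Re_fv_exponent)
  also have "\<dots> \<ge> 0" by (intro integral_nonneg_AE) auto
  finally show ?thesis by simp
qed

lemma norm_fv_exponent_le:
  "ennreal (cmod (fv_exponent F z)) \<le> (\<integral>\<^sup>+x. ennreal (min 2 \<bar>z * x\<bar>) \<partial>F)"
proof -
  have "ennreal (cmod (fv_exponent F z)) \<le> (\<integral>\<^sup>+x. ennreal (cmod (iexp (z * x) - 1)) \<partial>F)"
    unfolding fv_exponent_def by (rule integral_norm_bound_ennreal[OF integrable_iexp_minus_one])
  also have "\<dots> \<le> (\<integral>\<^sup>+x. ennreal (min 2 \<bar>z * x\<bar>) \<partial>F)"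
    by (intro nn_integral_mono ennreal_leI norm_iexp_minus_one_le)
  finally show ?thesis .
qed

text \<open>Small jumps are integrable here, so the compensator can be split off; its integral
  becomes the drift coefficient of the truncated representation, and there is no Gaussian
  part.\<close>

lemma levy_khintchine_fv:
  assumes "emeasure F {0} = 0" and "\<And>z. char \<mu> z = exp (fv_exponent F z)"
  shows "levy_khintchine \<mu> (\<integral>x. x * indicator {-1..1} x \<partial>F) 0 F"
  unfolding levy_khintchine_def
proof (intro conjI allI)
  have int: "integrable F (\<lambda>x. x * indicator {-1..1} x)"
    by (rule Bochner_Integration.integrable_bound[OF integrable_min_1_abs]) (auto simp: indicator_def)
  have "min 1 (x\<^sup>2) \<le> min 1 \<bar>x\<bar>" for x :: real
  proof (cases "\<bar>x\<bar> \<le> 1")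
    case True
    hence "\<bar>x\<bar> * \<bar>x\<bar> \<le> 1 * \<bar>x\<bar>" by (intro mult_right_mono) auto
    thus ?thesis by (auto simp: power2_eq_square)
  qed auto
  hence "(\<integral>\<^sup>+x. ennreal (min 1 (x\<^sup>2)) \<partial>F) \<le> (\<integral>\<^sup>+x. ennreal (min 1 \<bar>x\<bar>) \<partial>F)"
    by (intro nn_integral_mono ennreal_leI) auto
  thus "(\<integral>\<^sup>+x. ennreal (min 1 (x\<^sup>2)) \<partial>F) < \<infinity>" using finite_variation by (rule le_less_trans)
  fix z
  have "(CLINT x|F. iexp (z * x) - 1 - \<i> * of_real (z * x * indicator {-1..1} x)) =
    (CLINT x|F. (iexp (z * x) - 1) - \<i> * of_real z * of_real (x * indicator {-1..1} x))"
    by (simp add: mult.assoc)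
  also have "\<dots> = fv_exponent F z - \<i> * of_real z * of_real (\<integral>x. x * indicator {-1..1} x \<partial>F)"
    unfolding fv_exponent_def
    using integrable_mult_right[OF integrable_of_real[OF int, where 'a = complex], of "\<i> * of_real z"]
    by (subst Bochner_Integration.integral_diff[OF integrable_iexp_minus_one])
      (simp_all only: integral_mult_right_zero integral_complex_of_real)
  finally show "char \<mu> z =
        exp (\<i> * of_real ((\<integral>x. x * indicator {-1..1} x \<partial>F) * z) - of_real (0 * z\<^sup>2 / 2) +
          (CLINT x|F. iexp (z * x) - 1 - \<i> * of_real (z * x * indicator {-1..1} x)))"
    by (simp add: assms(2) mult.assoc mult.commute)
qed (use assms(1) in auto)

section \<open>Passing between small-time laws and the Levy measure\<close>

lemma nn_integral_one_minus_cos_eq_of_char: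
  assumes "real_distribution \<mu>"
  shows "(\<integral>\<^sup>+y. ennreal (1 - cos (z * y)) \<partial>\<mu>) = ennreal (Re (1 - char \<mu> z))"
proof -
  interpret \<mu>: real_distribution \<mu> by fact
  have "(\<integral>\<^sup>+y. ennreal (1 - cos (z * y)) \<partial>\<mu>) = ennreal (\<integral>y. 1 - cos (z * y) \<partial>\<mu>)"
    by (intro nn_integral_eq_integral \<mu>.integrable_const_bound[where B = 2]) auto
  also have "(\<integral>y. 1 - cos (z * y) \<partial>\<mu>) = (\<integral>y. Re (1 - iexp (z * y)) \<partial>\<mu>)"
    by (simp add: Re_exp)
  also have "\<dots> = Re (CLINT y|\<mu>. 1 - iexp (z * y))"
    by (intro integral_Re Bochner_Integration.integrable_diff \<mu>.integrable_iexp) auto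
  also have "(CLINT y|\<mu>. 1 - iexp (z * y)) = 1 - char \<mu> z"
    unfolding char_def by (subst Bochner_Integration.integral_diff) (auto intro!: \<mu>.integrable_iexp simp: \<mu>.prob_space simp del: \<mu>.space_eq_univ)
  finally show ?thesis .
qed

text \<open>Integrals are exchanged twice: the kernel 1 - cos turns the moment of the law into an
  integral of Re (1 - phi), and |psi (z)| <= int min 2 |z x| F(dx) turns this into the same moment
  of \<open>F\<close>. Constants stay as factors in \<open>ennreal\<close>, so the estimate makes
  sense with infinite values. The factor 2 comes from estimating the real and the imaginary part of
  h psi by h |psi| each.\<close>

lemma nn_integral_powr_le_of_char:
  assumes "real_distribution \<mu>" and char: "\<And>z. char \<mu> z = exp (of_real h * fv_exponent F z)"
    and h: "0 \<le> h" and p: "0 < p" "p < 1"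
  shows "(\<integral>\<^sup>+z. ennreal ((1 - cos z) * \<bar>z\<bar> powr (- 1 - p)) \<partial>lborel) * (\<integral>\<^sup>+y. ennreal (\<bar>y\<bar> powr p) \<partial>\<mu>) \<le>
    2 * ennreal h * ((\<integral>\<^sup>+z. ennreal (min 2 \<bar>z\<bar> * \<bar>z\<bar> powr (- 1 - p)) \<partial>lborel) * (\<integral>\<^sup>+x. ennreal (\<bar>x\<bar> powr p) \<partial>F))"
    (is "?K * ?E \<le> 2 * ennreal h * (?J * ?I)")
proof -
  interpret \<mu>: real_distribution \<mu> by fact
  interpret \<mu>l: pair_sigma_finite lborel \<mu> ..
  interpret Fl: pair_sigma_finite lborel F ..
  have "?K * ?E = (\<integral>\<^sup>+y. ennreal (\<bar>y\<bar> powr p) * ?K \<partial>\<mu>)"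
    by (subst nn_integral_multc) (auto simp: mult.commute)
  also have "\<dots> = (\<integral>\<^sup>+y. (\<integral>\<^sup>+z. ennreal ((1 - cos (z * y)) * \<bar>z\<bar> powr (- 1 - p)) \<partial>lborel) \<partial>\<mu>)"
    by (intro nn_integral_cong nn_integral_powr_scale[symmetric]) auto
  also have "\<dots> = (\<integral>\<^sup>+z. (\<integral>\<^sup>+y. ennreal ((1 - cos (z * y)) * \<bar>z\<bar> powr (- 1 - p)) \<partial>\<mu>) \<partial>lborel)"
    by (rule \<mu>l.Fubini') simp
  also have "\<dots> \<le> (\<integral>\<^sup>+z. 2 * ennreal h * (\<integral>\<^sup>+x. ennreal (min 2 \<bar>z * x\<bar> * \<bar>z\<bar> powr (- 1 - p)) \<partial>F) \<partial>lborel)"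
  proof (intro nn_integral_mono)
    fix z :: real
    define w where "w = \<bar>z\<bar> powr (- 1 - p)"
    have w: "0 \<le> w" by (simp add: w_def)
    note 1 = nn_integral_one_minus_cos_eq_of_char[OF assms(1), of z]
    define a b where "a = h * Re (fv_exponent F z)" and "b = h * Im (fv_exponent F z)"
    have a: "a \<le> 0" using Re_fv_exponent_le_0[of z] h by (simp add: a_def mult_nonneg_nonpos)
    \<comment> \<open>Since a <= 0, both terms are nonnegative and exp a <= 1; the imaginary part
      enters only through 1 - cos b <= |b|.\<close>
    have "Re (1 - char \<mu> z) = (1 - exp a) + exp a * (1 - cos b)"
      by (simp add: char Re_exp a_def b_def algebra_simps)
    also have "\<dots> \<le> - a + 1 * \<bar>b\<bar>"
    proof (intro add_mono mult_mono)
      show "1 - exp a \<le> - a" using exp_ge_add_one_self[of a] by linarith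
    qed (use a one_minus_cos_le[of b] in auto)
    also have "\<dots> \<le> h * cmod (fv_exponent F z) + h * cmod (fv_exponent F z)"
    proof (intro add_mono)
      show "- a \<le> h * cmod (fv_exponent F z)"
        using h abs_Re_le_cmod[of "fv_exponent F z"] Re_fv_exponent_le_0[of z] mult_left_mono[of "- Re (fv_exponent F z)" "cmod (fv_exponent F z)" h]
        by (simp add: a_def)
      show "1 * \<bar>b\<bar> \<le> h * cmod (fv_exponent F z)"
        using h abs_Im_le_cmod[of "fv_exponent F z"] by (simp add: b_def abs_mult mult_left_mono)
    qed
    finally have "ennreal (Re (1 - char \<mu> z)) \<le> ennreal (2 * h * cmod (fv_exponent F z))"
      by (intro ennreal_leI) simp
    also have "\<dots> = 2 * ennreal h * ennreal (cmod (fv_exponent F z))"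
      using h by (simp add: ennreal_mult)
    also have "\<dots> \<le> 2 * ennreal h * (\<integral>\<^sup>+x. ennreal (min 2 \<bar>z * x\<bar>) \<partial>F)"
      by (intro mult_left_mono norm_fv_exponent_le) auto
    finally have "(\<integral>\<^sup>+y. ennreal (1 - cos (z * y)) \<partial>\<mu>) * ennreal w \<le> 2 * ennreal h * (\<integral>\<^sup>+x. ennreal (min 2 \<bar>z * x\<bar>) \<partial>F) * ennreal w"
      unfolding 1 by (intro mult_right_mono) auto
    thus "(\<integral>\<^sup>+y. ennreal ((1 - cos (z * y)) * \<bar>z\<bar> powr (- 1 - p)) \<partial>\<mu>) \<le>
        2 * ennreal h * (\<integral>\<^sup>+x. ennreal (min 2 \<bar>z * x\<bar> * \<bar>z\<bar> powr (- 1 - p)) \<partial>F)"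
      unfolding w_def[symmetric] using w by (simp add: ennreal_mult nn_integral_multc mult.assoc)
  qed
  also have "\<dots> = 2 * ennreal h * (\<integral>\<^sup>+z. (\<integral>\<^sup>+x. ennreal (min 2 \<bar>z * x\<bar> * \<bar>z\<bar> powr (- 1 - p)) \<partial>F) \<partial>lborel)"
    by (rule nn_integral_cmult) measurable
  also have "(\<integral>\<^sup>+z. (\<integral>\<^sup>+x. ennreal (min 2 \<bar>z * x\<bar> * \<bar>z\<bar> powr (- 1 - p)) \<partial>F) \<partial>lborel) =
      (\<integral>\<^sup>+x. (\<integral>\<^sup>+z. ennreal (min 2 \<bar>z * x\<bar> * \<bar>z\<bar> powr (- 1 - p)) \<partial>lborel) \<partial>F)"
    by (rule Fl.Fubini'[symmetric]) simp
  also have "\<dots> = (\<integral>\<^sup>+x. ennreal (\<bar>x\<bar> powr p) * ?J \<partial>F)"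
    by (intro nn_integral_cong nn_integral_powr_scale) auto
  also have "\<dots> = ?J * ?I"
    by (subst nn_integral_multc) (auto simp: mult.commute)
  finally show ?thesis .
qed

text \<open>\<open>W\<close>, the kernel integral over |z| >= 1, is estimated on both sides: 4 J (1
  - exp (- |y|^q)) dominates it for every y, and it dominates c |x|^q on [-1, 1]. Fatou's lemma in
  the frequency variable links the two, since (1 / h) Re (1 - phi_h) converges pointwise to - Re
  psi, whose weighted integral is that of \<open>W\<close> against \<open>F\<close>.\<close>

lemma eventually_nn_integral_one_minus_exp_of_char:
  assumes \<mu>: "\<And>n. real_distribution (\<mu> n)"
    and char: "\<And>n z. char (\<mu> n) z = exp (of_real (h n) * fv_exponent F z)"
    and h: "\<And>n. 0 < h n" "h \<longlonglongrightarrow> 0" and q: "0 < q" "q < 1"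
    and inf: "(\<integral>\<^sup>+x\<in>{-1..1}. ennreal (\<bar>x\<bar> powr q) \<partial>F) = \<infinity>"
  shows "\<forall>\<^sub>F n in sequentially. ennreal B < ennreal (1 / h n) * (\<integral>\<^sup>+y. ennreal (1 - exp (- (\<bar>y\<bar> powr q))) \<partial>\<mu> n)"
proof -
  let ?w = "\<lambda>z. \<bar>z\<bar> powr (- 1 - q)"
  define J where "J = (\<integral>\<^sup>+z. ennreal (min 2 \<bar>z\<bar> * ?w z) \<partial>lborel)"
  define c where "c = (\<integral>\<^sup>+z\<in>{z. 1 \<le> \<bar>z\<bar>}. ennreal ((1 - cos z) * ?w z) \<partial>lborel)"
  define W where "W y = (\<integral>\<^sup>+z\<in>{z. 1 \<le> \<bar>z\<bar>}. ennreal ((1 - cos (z * y)) * ?w z) \<partial>lborel)" for y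
  have [measurable]: "char (\<mu> n) \<in> borel_measurable borel" for n
    by (rule real_distribution.char_measurable[OF \<mu>])
  have [measurable]: "W \<in> borel_measurable borel" unfolding W_def by measurable
  have J: "J < \<infinity>" unfolding J_def using q by (rule nn_integral_min_powr_finite)
  have c: "0 < c" unfolding c_def using q by (intro nn_integral_one_minus_cos_powr_pos)
  have W_le: "W y \<le> 4 * J * ennreal (1 - exp (- (\<bar>y\<bar> powr q)))" for y
  proof -
    have "W y \<le> (\<integral>\<^sup>+z. ennreal (min 2 \<bar>z * y\<bar> * ?w z) \<partial>lborel)"
      unfolding W_def
      by (intro nn_integral_mono) (auto simp: indicator_def intro!: ennreal_leI mult_right_mono one_minus_cos_le)
    also have "\<dots> = ennreal (\<bar>y\<bar> powr q) * J"
      unfolding J_def by (intro nn_integral_powr_scale) auto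
    also have "\<dots> \<le> ennreal (2 * \<bar>y\<bar> powr q) * J" by (intro mult_right_mono ennreal_leI) auto
    finally have 1: "W y \<le> ennreal (2 * \<bar>y\<bar> powr q) * J" .
    have "W y \<le> (\<integral>\<^sup>+z. 2 * ennreal (min 2 \<bar>z\<bar> * ?w z) \<partial>lborel)"
      unfolding W_def
    proof (intro nn_integral_mono)
      fix z :: real
      have eq: "2 * ennreal (min 2 \<bar>z\<bar> * ?w z) = ennreal (2 * (min 2 \<bar>z\<bar> * ?w z))"
        by (subst ennreal_mult) auto
      have "(1 - cos (z * y)) * ?w z \<le> 2 * (min 2 \<bar>z\<bar> * ?w z)" if "1 \<le> \<bar>z\<bar>"
        unfolding mult.assoc[symmetric]
        using that cos_ge_minus_one[of "z * y"] by (intro mult_right_mono) (linarith, simp)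
      thus "ennreal ((1 - cos (z * y)) * ?w z) * indicator {z. 1 \<le> \<bar>z\<bar>} z \<le> 2 * ennreal (min 2 \<bar>z\<bar> * ?w z)"
        unfolding eq by (auto simp: indicator_def intro!: ennreal_leI)
    qed
    also have "\<dots> = 2 * J" unfolding J_def by (subst nn_integral_cmult) auto
    finally have 2: "W y \<le> ennreal 2 * J" by simp
    \<comment> \<open>Two bounds are merged: scaling gives |y|^q J, and 1 - cos <= 2 on |z| >= 1
      gives 2 J.\<close>
    have "W y \<le> ennreal (2 * min 1 (\<bar>y\<bar> powr q)) * J"
      using 1 2 by (auto simp: min_def)
    also have "\<dots> \<le> ennreal (4 * (1 - exp (- (\<bar>y\<bar> powr q)))) * J"
      using one_minus_exp_neg_ge[of "\<bar>y\<bar> powr q"] by (intro mult_right_mono ennreal_leI) auto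
    also have "\<dots> = 4 * J * ennreal (1 - exp (- (\<bar>y\<bar> powr q)))"
      by (subst ennreal_mult) (auto simp: mult_ac)
    finally show ?thesis .
  qed
  \<comment> \<open>Scaling the truncated kernel produces the region |z x| >= 1, which lies in |z|
    >= 1 because |x| <= 1.\<close>
  have W_ge: "ennreal (\<bar>x\<bar> powr q) * c \<le> W x" if x: "\<bar>x\<bar> \<le> 1" for x
  proof -
    have "ennreal (\<bar>x\<bar> powr q) * c =
      ennreal (\<bar>x\<bar> powr q) * (\<integral>\<^sup>+z. ennreal ((1 - cos z) * indicator {z. 1 \<le> \<bar>z\<bar>} z * ?w z) \<partial>lborel)"
      unfolding c_def by (intro arg_cong[of _ _ "\<lambda>I. _ * I"] nn_integral_cong) (auto simp: indicator_def)
    also have "\<dots> = (\<integral>\<^sup>+z. ennreal ((1 - cos (z * x)) * indicator {z. 1 \<le> \<bar>z\<bar>} (z * x) * ?w z) \<partial>lborel)"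
      by (intro nn_integral_powr_scale[symmetric]) (auto simp: indicator_def)
    also have "\<dots> \<le> W x"
      unfolding W_def
    proof (intro nn_integral_mono)
      fix z :: real
      have "1 \<le> \<bar>z\<bar>" if "1 \<le> \<bar>z * x\<bar>"
        using that x mult_left_mono[of "\<bar>x\<bar>" 1 "\<bar>z\<bar>"] by (simp add: abs_mult)
      thus "ennreal ((1 - cos (z * x)) * indicator {z. 1 \<le> \<bar>z\<bar>} (z * x) * ?w z)
        \<le> ennreal ((1 - cos (z * x)) * ?w z) * indicator {z. 1 \<le> \<bar>z\<bar>} z"
        by (auto simp: indicator_def)
    qed
    finally show ?thesis .
  qed
  define b where "b n = ennreal (1 / h n) * (\<integral>\<^sup>+y. W y \<partial>\<mu> n)" for n
  let ?g = "\<lambda>n z. ennreal (Re (1 - char (\<mu> n) z) / h n) * (ennreal (?w z) * indicator {z. 1 \<le> \<bar>z\<bar>} z)"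
  have b_eq: "b n = (\<integral>\<^sup>+z. ?g n z \<partial>lborel)" for n
  proof -
    interpret \<mu>: real_distribution "\<mu> n" by fact
    interpret \<mu>l: pair_sigma_finite lborel "\<mu> n" ..
    have "(\<integral>\<^sup>+y. W y \<partial>\<mu> n) =
      (\<integral>\<^sup>+z. (\<integral>\<^sup>+y. ennreal ((1 - cos (z * y)) * ?w z) * indicator {z. 1 \<le> \<bar>z\<bar>} z \<partial>\<mu> n) \<partial>lborel)"
      unfolding W_def by (rule \<mu>l.Fubini') measurable
    also have "\<dots> = (\<integral>\<^sup>+z. ennreal (Re (1 - char (\<mu> n) z)) * (ennreal (?w z) * indicator {z. 1 \<le> \<bar>z\<bar>} z) \<partial>lborel)"
      by (intro nn_integral_cong)
        (simp add: ennreal_mult nn_integral_multc mult.assoc nn_integral_one_minus_cos_eq_of_char[OF \<mu>])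
    finally have "b n = (\<integral>\<^sup>+z. ennreal (1 / h n) * (ennreal (Re (1 - char (\<mu> n) z)) * (ennreal (?w z) * indicator {z. 1 \<le> \<bar>z\<bar>} z)) \<partial>lborel)"
      unfolding b_def by (subst nn_integral_cmult) auto
    also have "\<dots> = (\<integral>\<^sup>+z. ?g n z \<partial>lborel)"
      using h(1)[of n] by (intro nn_integral_cong) (simp add: mult.assoc[symmetric] flip: ennreal_mult')
    finally show ?thesis .
  qed
  have lim: "(\<lambda>n. ?g n z) \<longlonglongrightarrow> ennreal (- Re (fv_exponent F z)) * (ennreal (?w z) * indicator {z. 1 \<le> \<bar>z\<bar>} z)" for z
  proof (intro tendsto_mult_ennreal tendsto_ennrealI tendsto_const)
    \<comment> \<open>The limit is the derivative of s |-> exp (s psi) at 0, taken along the nonzero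
      values h n.\<close>
    have "((\<lambda>s. exp (s * fv_exponent F z)) has_field_derivative fv_exponent F z) (at 0)"
      by (auto intro!: derivative_eq_intros)
    hence "((\<lambda>s. (exp (s * fv_exponent F z) - 1) / s) \<longlongrightarrow> fv_exponent F z) (at 0)"
      by (simp add: has_field_derivative_iff)
    moreover have "filterlim (\<lambda>n. complex_of_real (h n)) (at 0) sequentially"
      using h(1) tendsto_of_real[OF h(2), where 'a = complex] by (auto simp: filterlim_at intro!: always_eventually dest: less_imp_neq[THEN not_sym])
    ultimately have "(\<lambda>n. (exp (of_real (h n) * fv_exponent F z) - 1) / of_real (h n)) \<longlonglongrightarrow> fv_exponent F z"
      by (rule filterlim_compose)
    hence "(\<lambda>n. - Re ((exp (of_real (h n) * fv_exponent F z) - 1) / of_real (h n))) \<longlonglongrightarrow> - Re (fv_exponent F z)"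
      by (intro tendsto_intros)
    also have "(\<lambda>n. - Re ((exp (of_real (h n) * fv_exponent F z) - 1) / of_real (h n))) =
        (\<lambda>n. Re (1 - char (\<mu> n) z) / h n)"
      by (simp add: fun_eq_iff char minus_divide_left)
    finally show "(\<lambda>n. Re (1 - char (\<mu> n) z) / h n) \<longlonglongrightarrow> - Re (fv_exponent F z)" .
  qed (auto simp: indicator_def)
  have "liminf b = \<infinity>"
  proof -
    interpret Fl: pair_sigma_finite lborel F ..
    have "(\<integral>\<^sup>+x\<in>{-1..1}. ennreal (\<bar>x\<bar> powr q) \<partial>F) * c = (\<integral>\<^sup>+x. ennreal (\<bar>x\<bar> powr q) * indicator {-1..1} x * c \<partial>F)"
      by (subst nn_integral_multc) auto
    also have "\<dots> \<le> (\<integral>\<^sup>+x. W x \<partial>F)"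
      by (intro nn_integral_mono) (auto simp: indicator_def intro!: W_ge)
    also have "\<dots> = (\<integral>\<^sup>+z. (\<integral>\<^sup>+x. ennreal ((1 - cos (z * x)) * ?w z) * indicator {z. 1 \<le> \<bar>z\<bar>} z \<partial>F) \<partial>lborel)"
      unfolding W_def by (rule Fl.Fubini') measurable
    also have "\<dots> = (\<integral>\<^sup>+z. ennreal (- Re (fv_exponent F z)) * (ennreal (?w z) * indicator {z. 1 \<le> \<bar>z\<bar>} z) \<partial>lborel)"
      by (intro nn_integral_cong)
        (simp add: ennreal_mult nn_integral_multc mult.assoc ennreal_minus_Re_fv_exponent)
    also have "\<dots> = (\<integral>\<^sup>+z. liminf (\<lambda>n. ?g n z) \<partial>lborel)"
      by (intro nn_integral_cong lim_imp_Liminf[symmetric] lim) auto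
    also have "\<dots> \<le> liminf (\<lambda>n. \<integral>\<^sup>+z. ?g n z \<partial>lborel)"
      by (intro nn_integral_liminf) measurable
    also have "\<dots> = liminf b" unfolding b_eq[symmetric] ..
    finally show ?thesis using inf c by (simp add: ennreal_top_mult top_unique split: if_splits)
  qed
  have "ennreal B * (4 * J) < \<infinity>" using J by (simp add: ennreal_mult_less_top)
  hence "\<forall>\<^sub>F n in sequentially. ennreal B * (4 * J) < b n"
    by (intro less_LiminfD) (simp add: \<open>liminf b = \<infinity>\<close>)
  thus ?thesis
  proof eventually_elim
    case (elim n)
    interpret \<mu>: real_distribution "\<mu> n" by fact
    let ?a = "\<integral>\<^sup>+y. ennreal (1 - exp (- (\<bar>y\<bar> powr q))) \<partial>\<mu> n"
    have "b n \<le> ennreal (1 / h n) * (\<integral>\<^sup>+y. 4 * J * ennreal (1 - exp (- (\<bar>y\<bar> powr q))) \<partial>\<mu> n)"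
      unfolding b_def by (intro mult_left_mono nn_integral_mono W_le) auto
    also have "\<dots> = ennreal (1 / h n) * ?a * (4 * J)"
      by (subst nn_integral_cmult) (auto simp: mult_ac)
    finally have "ennreal B * (4 * J) < ennreal (1 / h n) * ?a * (4 * J)" using elim by order
    thus ?case by (metis leI mult_right_mono not_le zero_le)
  qed
qed

end

section \<open>Dyadic \<open>p\<close>-variation\<close>

text \<open>After division by a + b the summands u lie in [0, 1], where u <= u^p.\<close>

lemma powr_abs_add_le:
  fixes x y :: real
  assumes "0 < p" "p \<le> 1"
  shows "\<bar>x + y\<bar> powr p \<le> \<bar>x\<bar> powr p + \<bar>y\<bar> powr p"
proof -
  have *: "(a + b) powr p \<le> a powr p + b powr p" if "0 \<le> a" "0 \<le> b" for a b :: real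
  proof (cases "a + b = 0")
    case True thus ?thesis using that by simp
  next
    case False
    hence s: "0 < a + b" using that by linarith
    have *: "u \<le> u powr p" if "0 \<le> u" "u \<le> 1" for u :: real
      using that powr_mono'[of p 1 u] assms by simp
    have "1 = a / (a + b) + b / (a + b)" using s by (simp flip: add_divide_distrib)
    also have "\<dots> \<le> (a / (a + b)) powr p + (b / (a + b)) powr p"
      using that s by (intro add_mono *) (auto simp: field_simps)
    also have "\<dots> = (a powr p + b powr p) / (a + b) powr p"
      using that s by (simp add: powr_divide add_divide_distrib)
    finally show ?thesis using s by (simp add: field_simps)
  qed
  have "\<bar>x + y\<bar> powr p \<le> (\<bar>x\<bar> + \<bar>y\<bar>) powr p"
    using assms by (intro powr_mono2) auto
  thus ?thesis using *[of "\<bar>x\<bar>" "\<bar>y\<bar>"] by simp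
qed

lemma powr_abs_diff_le_sum:
  fixes f :: "nat \<Rightarrow> real"
  assumes "0 < p" "p \<le> 1" "m \<le> n"
  shows "\<bar>f n - f m\<bar> powr p \<le> (\<Sum>i=m..<n. \<bar>f (Suc i) - f i\<bar> powr p)"
  using \<open>m \<le> n\<close>
proof (induction n rule: dec_induct)
  case (step n)
  have "\<bar>f (Suc n) - f m\<bar> powr p \<le> \<bar>f (Suc n) - f n\<bar> powr p + \<bar>f n - f m\<bar> powr p"
    using powr_abs_add_le[OF assms(1,2), of "f (Suc n) - f n" "f n - f m"] by simp
  thus ?case using step by simp
qed simp

text \<open>The horizon is a natural number so that it is a grid point at every level and successive
  grids are nested.\<close>

definition dyadic_variation :: "real \<Rightarrow> (real \<Rightarrow> real) \<Rightarrow> nat \<Rightarrow> nat \<Rightarrow> real" where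
  "dyadic_variation p f N n = (\<Sum>i<N * 2 ^ n. \<bar>f (real (Suc i) / 2 ^ n) - f (real i / 2 ^ n)\<bar> powr p)"

lemma sum_even_odd: "(\<Sum>k<2 * m. g k) = (\<Sum>i<m. g (2 * i) + g (2 * i + 1 :: nat))"
  for g :: "nat \<Rightarrow> 'a::comm_monoid_add"
  by (induction m) (auto simp: add.assoc)

lemma dyadic_variation_mono:
  assumes "0 < p" "p \<le> 1"
  shows "dyadic_variation p f N n \<le> dyadic_variation p f N (Suc n)"
proof -
  define h where "h k = f (real k / 2 ^ Suc n)" for k
  let ?g = "\<lambda>k. \<bar>h (Suc k) - h k\<bar> powr p"
  have "\<bar>f (real (Suc i) / 2 ^ n) - f (real i / 2 ^ n)\<bar> powr p \<le> ?g (2 * i) + ?g (2 * i + 1)" for i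
  proof -
    have "f (real (Suc i) / 2 ^ n) = h (Suc (2 * i + 1))" "f (real i / 2 ^ n) = h (2 * i)"
      unfolding h_def by (rule arg_cong[of _ _ f], simp add: field_simps)+
    thus ?thesis
      using powr_abs_add_le[OF assms, of "h (Suc (2 * i)) - h (2 * i)" "h (Suc (2 * i + 1)) - h (2 * i + 1)"] by simp
  qed
  hence "dyadic_variation p f N n \<le> (\<Sum>i<N * 2 ^ n. ?g (2 * i) + ?g (2 * i + 1))"
    unfolding dyadic_variation_def by (rule sum_mono)
  also have "\<dots> = (\<Sum>k<2 * (N * 2 ^ n). ?g k)"
    by (rule sum_even_odd[symmetric])
  also have "\<dots> = dyadic_variation p f N (Suc n)"
    unfolding dyadic_variation_def h_def by (simp add: mult_ac)
  finally show ?thesis .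
qed

lemma dyadic_variation_le_p_variation:
  "ennreal (dyadic_variation p f 1 n) \<le> p_variation p f 1"
  unfolding p_variation_def dyadic_variation_def
  by (rule SUP_upper2[where i = "(2 ^ n, \<lambda>i. real i / 2 ^ n)"]) (auto simp: divide_strict_right_mono)

text \<open>Rounding up approaches t only from t itself or from its right, so right-continuity is
  enough.\<close>

lemma dyadic_ceiling_tendsto:
  fixes t :: real
  assumes "0 \<le> t" "(f \<longlongrightarrow> f t) (at_right t)"
  shows "(\<lambda>n. f (real (nat \<lceil>t * 2 ^ n\<rceil>) / 2 ^ n)) \<longlonglongrightarrow> f t"
proof -
  let ?d = "\<lambda>n. real (nat \<lceil>t * 2 ^ n\<rceil>) / 2 ^ n"
  have eq: "real (nat \<lceil>t * 2 ^ n\<rceil>) = of_int \<lceil>t * 2 ^ n\<rceil>" for n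
  proof (rule of_nat_nat)
    have "0 \<le> t * 2 ^ n" using assms(1) by simp
    thus "0 \<le> \<lceil>t * 2 ^ n\<rceil>" by linarith
  qed
  have ge: "t \<le> ?d n" for n
    unfolding eq by (simp add: pos_le_divide_eq le_of_int_ceiling)
  have le: "?d n \<le> t + 1 / 2 ^ n" for n
  proof -
    have "of_int \<lceil>t * 2 ^ n\<rceil> \<le> t * 2 ^ n + 1" by (rule of_int_ceiling_le_add_one)
    thus ?thesis unfolding eq by (simp add: field_simps)
  qed
  have "(\<lambda>n. t + 1 / 2 ^ n) \<longlonglongrightarrow> t + 0"
    by (intro tendsto_intros) (use LIMSEQ_inverse_realpow_zero[of 2] in \<open>simp add: inverse_eq_divide\<close>)
  hence lim: "?d \<longlonglongrightarrow> t"
    using ge le by (intro tendsto_sandwich[of "\<lambda>_. t" ?d _ "\<lambda>n. t + 1 / 2 ^ n"] always_eventually) auto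
  have "(f \<longlongrightarrow> f t) (at t within {t..})"
    using assms(2) by (simp add: at_within_Ici_at_right)
  \<comment> \<open>The approximants may equal t, as they do eventually for dyadic t, so the filter
    must include the point itself.\<close>
  hence "((\<lambda>x. f x) \<longlongrightarrow> f t) (inf (nhds t) (principal {t..}))"
    by (simp add: tendsto_at_iff_tendsto_nhds_within)
  moreover have "filterlim ?d (inf (nhds t) (principal {t..})) sequentially"
    unfolding filterlim_inf filterlim_principal using lim ge by auto
  ultimately show ?thesis by (rule filterlim_compose)
qed

text \<open>Every partition point is rounded up to the grid. A rounded increment is bounded by the
  grid increments that it spans, so the rounded sum is at most the dyadic one; on finer grids it
  tends to the original sum by right-continuity. Points that coincide after rounding contribute
  zero.\<close>

lemma p_variation_le_dyadic_variation:
  assumes p: "0 < p" "p \<le> 1" and f: "\<And>t. 0 \<le> t \<Longrightarrow> (f \<longlongrightarrow> f t) (at_right t)"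
    and bound: "\<And>n. dyadic_variation p f N n \<le> B" and t: "t \<le> real N"
  shows "p_variation p f t \<le> ennreal B"
  unfolding p_variation_def
proof (intro SUP_least, clarsimp intro!: ennreal_leI)
  fix m :: nat and \<tau> :: "nat \<Rightarrow> real"
  assume \<tau>: "\<tau> 0 = 0" "\<forall>i<m. \<tau> i < \<tau> (Suc i)" "t = \<tau> m"
  have mono: "\<tau> i \<le> \<tau> j" if "i \<le> j" "j \<le> m" for i j
    using that
  proof (induction j rule: dec_induct)
    case (step k)
    thus ?case using \<tau>(2)[rule_format, of k] by simp
  qed simp
  have nonneg: "0 \<le> \<tau> i" if "i \<le> m" for i
    using mono[of 0 i] that \<tau>(1) by simp
  define d where "d n i = nat \<lceil>\<tau> i * 2 ^ n\<rceil>" for n i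
  have d_mono: "d n i \<le> d n (Suc i)" if "i < m" for n i
    unfolding d_def using that \<tau>(2) by (intro nat_mono ceiling_mono mult_right_mono) (auto intro: less_imp_le)
  \<comment> \<open>Rounding up cannot pass N, which is itself a grid point.\<close>
  have d_m: "d n m \<le> N * 2 ^ n" for n
  proof -
    have "\<lceil>\<tau> m * 2 ^ n\<rceil> \<le> int (N * 2 ^ n)"
      using t \<tau>(3) by (simp add: ceiling_le_iff)
    thus ?thesis unfolding d_def by linarith
  qed
  have le: "(\<Sum>i<m. \<bar>f (real (d n (Suc i)) / 2 ^ n) - f (real (d n i) / 2 ^ n)\<bar> powr p) \<le> B" for n
  proof -
    let ?g = "\<lambda>k. \<bar>f (real (Suc k) / 2 ^ n) - f (real k / 2 ^ n)\<bar> powr p"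
    have "(\<Sum>i<k. \<bar>f (real (d n (Suc i)) / 2 ^ n) - f (real (d n i) / 2 ^ n)\<bar> powr p) \<le> (\<Sum>k<d n k. ?g k)"
      if "k \<le> m" for k
      using that
    proof (induction k)
      case (Suc k)
      have "\<bar>f (real (d n (Suc k)) / 2 ^ n) - f (real (d n k) / 2 ^ n)\<bar> powr p \<le> (\<Sum>k=d n k..<d n (Suc k). ?g k)"
        using Suc.prems by (intro powr_abs_diff_le_sum[where f = "\<lambda>k. f (real k / 2 ^ n)"] p d_mono) auto
      moreover have "(\<Sum>k<d n (Suc k). ?g k) = (\<Sum>k<d n k. ?g k) + (\<Sum>k=d n k..<d n (Suc k). ?g k)"
        using d_mono[of k n] Suc.prems sum.atLeastLessThan_concat[of 0 "d n k" "d n (Suc k)" ?g]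
        by (simp add: lessThan_atLeast0)
      ultimately show ?case using Suc by simp
    qed (simp add: sum_nonneg)
    from this[of m] have "(\<Sum>i<m. \<bar>f (real (d n (Suc i)) / 2 ^ n) - f (real (d n i) / 2 ^ n)\<bar> powr p) \<le> (\<Sum>k<d n m. ?g k)"
      by simp
    also have "\<dots> \<le> dyadic_variation p f N n"
      unfolding dyadic_variation_def using d_m[of n] by (intro sum_mono2) auto
    finally show ?thesis using bound[of n] by linarith
  qed
  have "(\<lambda>n. \<Sum>i<m. \<bar>f (real (d n (Suc i)) / 2 ^ n) - f (real (d n i) / 2 ^ n)\<bar> powr p)
      \<longlonglongrightarrow> (\<Sum>i<m. \<bar>f (\<tau> (Suc i)) - f (\<tau> i)\<bar> powr p)"
    unfolding d_def using p
    by (intro tendsto_sum tendsto_powr' tendsto_rabs tendsto_diff tendsto_const dyadic_ceiling_tendsto f nonneg) auto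
  thus "(\<Sum>i<m. \<bar>f (\<tau> (Suc i)) - f (\<tau> i)\<bar> powr p) \<le> B"
    by (rule LIMSEQ_le_const2) (use le in auto)
qed

text \<open>A p-variation equal to B bounds each increment by B^(1/p); then |x|^q = |x|^(q-p) |x|^p
  loses only a constant factor.\<close>

lemma p_variation_finite_mono:
  assumes fin: "p_variation p f t < \<infinity>" and pq: "0 < p" "p \<le> q"
  shows "p_variation q f t < \<infinity>"
proof -
  obtain B where B: "p_variation p f t = ennreal B" "0 \<le> B"
    using fin by (cases "p_variation p f t") auto
  have "p_variation q f t \<le> ennreal (max 1 B powr ((q - p) / p) * B)"
    unfolding p_variation_def
  proof (intro SUP_least, clarsimp intro!: ennreal_leI)
    fix m :: nat and \<tau> :: "nat \<Rightarrow> real"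
    assume \<tau>: "\<tau> 0 = 0" "\<forall>i<m. \<tau> i < \<tau> (Suc i)" "t = \<tau> m"
    let ?x = "\<lambda>i. \<bar>f (\<tau> (Suc i)) - f (\<tau> i)\<bar>"
    have "ennreal (\<Sum>i<m. ?x i powr p) \<le> p_variation p f t"
      unfolding p_variation_def using \<tau> by (intro SUP_upper2[where i = "(m, \<tau>)"]) auto
    hence sum: "(\<Sum>i<m. ?x i powr p) \<le> B" using B by simp
    have "?x i powr q \<le> max 1 B powr ((q - p) / p) * ?x i powr p" if "i < m" for i
    proof -
      have "?x i powr p \<le> (\<Sum>i<m. ?x i powr p)" using that by (intro member_le_sum) auto
      hence "?x i powr p \<le> max 1 B" using sum by linarith
      hence "(?x i powr p) powr ((q - p) / p) \<le> max 1 B powr ((q - p) / p)"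
        using pq by (intro powr_mono2) auto
      hence "?x i powr (q - p) \<le> max 1 B powr ((q - p) / p)" using pq by (simp add: powr_powr)
      hence "?x i powr (q - p) * ?x i powr p \<le> max 1 B powr ((q - p) / p) * ?x i powr p"
        by (intro mult_right_mono) auto
      thus ?thesis by (simp flip: powr_add)
    qed
    hence "(\<Sum>i<m. ?x i powr q) \<le> (\<Sum>i<m. max 1 B powr ((q - p) / p) * ?x i powr p)"
      by (intro sum_mono) auto
    also have "\<dots> = max 1 B powr ((q - p) / p) * (\<Sum>i<m. ?x i powr p)" by (simp add: sum_distrib_left)
    also have "\<dots> \<le> max 1 B powr ((q - p) / p) * B" using sum by (intro mult_left_mono) auto
    finally show "(\<Sum>i<m. ?x i powr q) \<le> max 1 B powr ((q - p) / p) * B" .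
  qed
  thus ?thesis by (rule le_less_trans) simp
qed

text \<open>Monotonicity in the exponent lets two sequences determine the infimum, and for countably
  many exponents almost sure statements can be intersected. Nonpositive q k carry no obligation, so
  b = 0 may be approached from below.\<close>

lemma p_variation_index_eqI:
  assumes fin: "\<And>k. 0 < p k \<and> (\<forall>t\<ge>0. p_variation (p k) f t < \<infinity>)" and p: "p \<longlonglongrightarrow> b"
    and inf: "\<And>k. 0 < q k \<Longrightarrow> p_variation (q k) f 1 = \<infinity>" and q: "q \<longlonglongrightarrow> b"
  shows "p_variation_index f = ereal b"
  unfolding p_variation_index_def
proof (rule antisym)
  let ?S = "{p. 0 < p \<and> (\<forall>t\<ge>0. p_variation p f t < \<infinity>)}"
  have "Inf (ereal ` ?S) \<le> ereal (p k)" for k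
    using fin[of k] by (intro INF_lower) auto
  thus "Inf (ereal ` ?S) \<le> ereal b"
    by (intro LIMSEQ_le_const[of "\<lambda>k. ereal (p k)"] tendsto_ereal p) auto
  show "ereal b \<le> Inf (ereal ` ?S)"
  proof (rule INF_greatest)
    fix r assume r: "r \<in> ?S"
    have "q k \<le> r" for k
    proof (rule ccontr)
      assume "\<not> q k \<le> r"
      hence "r \<le> q k" "0 < q k" using r by auto
      moreover have "p_variation r f 1 < \<infinity>" "0 < r" using r by (auto elim!: allE[of _ 1])
      ultimately have "p_variation (q k) f 1 < \<infinity>" by (intro p_variation_finite_mono[of r f 1 "q k"])
      thus False using inf[OF \<open>0 < q k\<close>] by simp
    qed
    hence "b \<le> r" using q by (intro LIMSEQ_le_const2[of q]) auto
    thus "ereal b \<le> ereal r" by simp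
  qed
qed

section \<open>Levy processes of finite variation without drift\<close>

lemma (in levy_process) measurable_increment [measurable]:
  "0 \<le> s \<Longrightarrow> 0 \<le> t \<Longrightarrow> (\<lambda>\<omega>. X t \<omega> - X s \<omega>) \<in> borel_measurable M"
  by (intro borel_measurable_diff measurable_X)

lemma (in levy_process) distr_increment:
  assumes "0 \<le> s" "s \<le> t"
  shows "distr M borel (\<lambda>\<omega>. X t \<omega> - X s \<omega>) = distr M borel (X (t - s))"
proof -
  have "distr M borel (\<lambda>\<omega>. X t \<omega> - X s \<omega>) = distr M borel (\<lambda>\<omega>. X (t - s) \<omega> - X 0 \<omega>)"
    using stationary_increments[of s "t - s"] assms by simp
  also have "\<dots> = distr M borel (X (t - s))"
    using X_zero assms by (intro distr_cong_AE) (auto intro: measurable_X measurable_increment)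
  finally show ?thesis .
qed

lemma (in levy_process) real_distribution_X: "0 \<le> t \<Longrightarrow> real_distribution (distr M borel (X t))"
  by (intro real_distribution_distr measurable_X)

locale fv_levy_process = levy_process M X + F: fv_levy_measure F
  for M :: "'a measure" and X and F +
  assumes char_X_1: "char (distr M borel (X 1)) z = exp (fv_exponent F z)"
begin

text \<open>Both sides are continuous \<open>2 ^ n\<close>-th roots of the characteristic function of \<open>X 1\<close> with
  value \<open>1\<close> at \<open>0\<close>.\<close>

lemma char_X_dyadic:
  "char (distr M borel (X (1 / 2 ^ n))) z = exp (of_real (1 / 2 ^ n) * fv_exponent F z)"
proof -
  define h :: real where "h = 1 / 2 ^ n"
  have h: "0 \<le> h" "real (2 ^ n) * h = 1" by (auto simp: h_def)
  define \<tau> where "\<tau> i = real i * h" for i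
  have "\<tau> i \<le> \<tau> (Suc i)" and \<tau>_nonneg: "0 \<le> \<tau> i" for i
    using h by (auto simp: \<tau>_def mult_right_mono)
  let ?D = "\<lambda>i \<omega>. X (\<tau> (Suc i)) \<omega> - X (\<tau> i) \<omega>"
  have indep: "indep_vars (\<lambda>_. borel) ?D {..<2 ^ n}"
    by (rule independent_increments) (auto simp: \<tau>_def h_def divide_strict_right_mono)
  have distr_D: "distr M borel (?D i) = distr M borel (X h)" for i
    using distr_increment[of "\<tau> i" "\<tau> (Suc i)"] \<open>\<tau> i \<le> \<tau> (Suc i)\<close> \<tau>_nonneg[of i]
    by (simp add: \<tau>_def algebra_simps)
  have "distr M borel (X 1) = distr M borel (\<lambda>\<omega>. \<Sum>i<2 ^ n. ?D i \<omega>)"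
  proof (intro distr_cong_AE)
    have "(\<Sum>i<2 ^ n. ?D i \<omega>) = X (\<tau> (2 ^ n)) \<omega> - X (\<tau> 0) \<omega>" for \<omega>
      by (rule sum_lessThan_telescope)
    thus "AE \<omega> in M. X 1 \<omega> = (\<Sum>i<2 ^ n. ?D i \<omega>)"
      using X_zero h by (auto simp: \<tau>_def)
  qed (auto intro!: measurable_X borel_measurable_sum measurable_increment \<tau>_nonneg)
  hence power: "char (distr M borel (X h)) z ^ 2 ^ n = exp (fv_exponent F z)" for z
    using char_distr_sum[OF indep, of z] char_X_1[of z] by (simp add: distr_D)
  interpret \<mu>: real_distribution "distr M borel (X h)" by (rule real_distribution_X) fact
  define g where "g z = char (distr M borel (X h)) z * exp (- (of_real h * fv_exponent F z))" for z
  have "continuous_on UNIV g"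
    unfolding g_def
    by (intro continuous_intros continuous_at_imp_continuous_on ballI \<mu>.isCont_char F.isCont_fv_exponent)
  moreover have "g 0 = 1" by (simp add: g_def \<mu>.char_zero F.fv_exponent_0)
  moreover have "g z ^ 2 ^ n = 1" for z
  proof -
    have "of_nat (2 ^ n) * complex_of_real h = 1" by (simp add: h_def)
    moreover have "exp (- (of_real h * fv_exponent F z)) ^ 2 ^ n = exp (of_nat (2 ^ n) * - (of_real h * fv_exponent F z))"
      by (rule exp_of_nat_mult[symmetric])
    moreover have "of_nat (2 ^ n) * - (of_real h * fv_exponent F z) = - (of_nat (2 ^ n) * of_real h * fv_exponent F z)"
      by (simp only: mult_minus_right mult.assoc)
    ultimately have "exp (- (of_real h * fv_exponent F z)) ^ 2 ^ n = exp (- fv_exponent F z)"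
      by (simp only: mult_1)
    thus ?thesis
      by (simp only: g_def power_mult_distrib power exp_minus_inverse)
  qed
  ultimately have "g z = 1" by (rule continuous_root_of_unity_imp_one[of g "2 ^ n"]) simp
  moreover have "char (distr M borel (X h)) z = g z * exp (of_real h * fv_exponent F z)"
    unfolding g_def by (simp only: mult.assoc exp_minus_inverse mult.commute[of "exp (- _)"] mult_1_right)
  ultimately have "char (distr M borel (X h)) z = exp (of_real h * fv_exponent F z)" by (simp only: mult_1)
  thus ?thesis by (simp add: h_def)
qed

section \<open>Sums over dyadic increments\<close>

lemma distr_dyadic_increment:
  "distr M borel (\<lambda>\<omega>. X (real (Suc i) / 2 ^ n) \<omega> - X (real i / 2 ^ n) \<omega>) = distr M borel (X (1 / 2 ^ n))"
proof -
  have "real (Suc i) / 2 ^ n - real i / 2 ^ n = 1 / 2 ^ n" by (simp flip: diff_divide_distrib)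
  thus ?thesis using distr_increment[of "real i / 2 ^ n" "real (Suc i) / 2 ^ n"]
    by (simp add: divide_right_mono)
qed

lemma nn_integral_dyadic_increment:
  assumes [measurable]: "f \<in> borel_measurable borel"
  shows "(\<integral>\<^sup>+\<omega>. f (X (real (Suc i) / 2 ^ n) \<omega> - X (real i / 2 ^ n) \<omega>) \<partial>M) =
    (\<integral>\<^sup>+y. f y \<partial>distr M borel (X (1 / 2 ^ n)))"
  unfolding distr_dyadic_increment[of i n, symmetric]
  by (rule nn_integral_distr[symmetric]) (auto intro: measurable_increment)

lemma measurable_dyadic_variation [measurable]:
  "(\<lambda>\<omega>. dyadic_variation p (\<lambda>t. X t \<omega>) N n) \<in> borel_measurable M"
  unfolding dyadic_variation_def
  by (intro borel_measurable_sum powr_real_measurable borel_measurable_abs measurable_increment) auto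

text \<open>Each of the N 2^n increments contributes a moment of order 2^-n, so the expected sums
  are bounded uniformly in n. Monotone convergence moves the supremum over levels inside the
  expectation, and an integrable supremum is finite almost surely.\<close>

lemma AE_dyadic_variation_bounded:
  assumes p: "0 < p" "p < 1" and fin: "(\<integral>\<^sup>+x. ennreal (\<bar>x\<bar> powr p) \<partial>F) < \<infinity>"
  shows "AE \<omega> in M. \<exists>B. \<forall>n. dyadic_variation p (\<lambda>t. X t \<omega>) N n \<le> B"
proof -
  let ?K = "\<integral>\<^sup>+z. ennreal ((1 - cos z) * \<bar>z\<bar> powr (- 1 - p)) \<partial>lborel"
  let ?J = "\<integral>\<^sup>+z. ennreal (min 2 \<bar>z\<bar> * \<bar>z\<bar> powr (- 1 - p)) \<partial>lborel"
  let ?I = "\<integral>\<^sup>+x. ennreal (\<bar>x\<bar> powr p) \<partial>F"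
  let ?V = "\<lambda>n \<omega>. ennreal (dyadic_variation p (\<lambda>t. X t \<omega>) N n)"
  \<comment> \<open>Positivity of \<open>?K\<close> is what lets finiteness of its product with the
    expectation pass to the expectation.\<close>
  have "0 < (\<integral>\<^sup>+z\<in>{z. 1 \<le> \<bar>z\<bar>}. ennreal ((1 - cos z) * \<bar>z\<bar> powr (- 1 - p)) \<partial>lborel)"
    using p by (intro nn_integral_one_minus_cos_powr_pos)
  also have "\<dots> \<le> ?K" by (intro nn_integral_mono) (auto simp: indicator_def)
  finally have K: "0 < ?K" .
  have "?K * (\<integral>\<^sup>+\<omega>. ?V n \<omega> \<partial>M) \<le> 2 * of_nat N * (?J * ?I)" for n
  proof -
    let ?E = "\<integral>\<^sup>+y. ennreal (\<bar>y\<bar> powr p) \<partial>distr M borel (X (1 / 2 ^ n))"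
    have "(\<integral>\<^sup>+\<omega>. ?V n \<omega> \<partial>M) =
      (\<integral>\<^sup>+\<omega>. (\<Sum>i<N * 2 ^ n. ennreal (\<bar>X (real (Suc i) / 2 ^ n) \<omega> - X (real i / 2 ^ n) \<omega>\<bar> powr p)) \<partial>M)"
      unfolding dyadic_variation_def by (simp add: sum_ennreal)
    also have "\<dots> = (\<Sum>i<N * 2 ^ n. (\<integral>\<^sup>+\<omega>. ennreal (\<bar>X (real (Suc i) / 2 ^ n) \<omega> - X (real i / 2 ^ n) \<omega>\<bar> powr p) \<partial>M))"
      by (intro nn_integral_sum measurable_compose[OF measurable_increment, of _ _ "\<lambda>y. ennreal (\<bar>y\<bar> powr p)"]) auto
    also have "\<dots> = (\<Sum>i<N * 2 ^ n. ?E)"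
      by (intro sum.cong refl nn_integral_dyadic_increment[where f = "\<lambda>y. ennreal (\<bar>y\<bar> powr p)"]) auto
    also have "\<dots> = of_nat (N * 2 ^ n) * ?E" by simp
    finally have "?K * (\<integral>\<^sup>+\<omega>. ?V n \<omega> \<partial>M) = of_nat (N * 2 ^ n) * (?K * ?E)"
      by (simp add: mult_ac)
    also have "\<dots> \<le> of_nat (N * 2 ^ n) * (2 * ennreal (1 / 2 ^ n) * (?J * ?I))"
      by (intro mult_left_mono F.nn_integral_powr_le_of_char real_distribution_X char_X_dyadic p) auto
    also have "\<dots> = of_nat N * (ennreal (2 ^ n) * ennreal (1 / 2 ^ n)) * 2 * (?J * ?I)"
      by (simp add: mult_ac ennreal_power flip: ennreal_numeral)
    also have "ennreal (2 ^ n) * ennreal (1 / 2 ^ n) = 1"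
      by (simp flip: ennreal_mult')
    finally show ?thesis by (simp add: mult_ac)
  qed
  hence "(SUP n. ?K * (\<integral>\<^sup>+\<omega>. ?V n \<omega> \<partial>M)) \<le> 2 * of_nat N * (?J * ?I)"
    by (intro SUP_least)
  also have "(SUP n. ?K * (\<integral>\<^sup>+\<omega>. ?V n \<omega> \<partial>M)) = ?K * (\<integral>\<^sup>+\<omega>. (SUP n. ?V n \<omega>) \<partial>M)"
    using p by (subst nn_integral_monotone_convergence_SUP)
      (auto simp: SUP_mult_left_ennreal intro!: incseq_SucI le_funI ennreal_leI dyadic_variation_mono)
  finally have "?K * (\<integral>\<^sup>+\<omega>. (SUP n. ?V n \<omega>) \<partial>M) \<le> 2 * of_nat N * (?J * ?I)" .
  also have "\<dots> < \<infinity>"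
    using fin nn_integral_min_powr_finite[OF p] by (simp add: ennreal_mult_less_top of_nat_less_top)
  finally have "(\<integral>\<^sup>+\<omega>. (SUP n. ?V n \<omega>) \<partial>M) \<noteq> \<infinity>"
    using K by (auto simp: ennreal_mult_less_top)
  hence "AE \<omega> in M. (SUP n. ?V n \<omega>) \<noteq> \<infinity>" by (intro nn_integral_PInf_AE) auto
  thus ?thesis
  proof eventually_elim
    case (elim \<omega>)
    obtain B where B: "(SUP n. ?V n \<omega>) = ennreal B" "0 \<le> B"
      using elim by (cases "SUP n. ?V n \<omega>") auto
    have "dyadic_variation p (\<lambda>t. X t \<omega>) N n \<le> B" for n
    proof -
      have "?V n \<omega> \<le> ennreal B" unfolding B(1)[symmetric] by (rule SUP_upper) simp
      thus ?thesis using B(2) by simp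
    qed
    thus ?case by blast
  qed
qed

lemma AE_p_variation_finite:
  assumes p: "0 < p" "p < 1" and fin: "(\<integral>\<^sup>+x. ennreal (\<bar>x\<bar> powr p) \<partial>F) < \<infinity>"
  shows "AE \<omega> in M. \<forall>t\<ge>0. p_variation p (\<lambda>t. X t \<omega>) t < \<infinity>"
proof -
  have "AE \<omega> in M. \<forall>N. \<exists>B. \<forall>n. dyadic_variation p (\<lambda>t. X t \<omega>) N n \<le> B"
    unfolding AE_all_countable using AE_dyadic_variation_bounded[OF assms] by blast
  thus ?thesis using cadlag_paths
  proof eventually_elim
    case (elim \<omega>)
    show ?case
    proof (intro allI impI)
      fix t :: real assume "0 \<le> t"
      obtain N where N: "t \<le> real N" using real_arch_simple by blast
      obtain B where "\<And>n. dyadic_variation p (\<lambda>t. X t \<omega>) N n \<le> B" using elim(1) by blast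
      hence "p_variation p (\<lambda>t. X t \<omega>) t \<le> ennreal B"
        using p N elim(2) by (intro p_variation_le_dyadic_variation[where N = N]) (auto simp: cadlag_def)
      thus "p_variation p (\<lambda>t. X t \<omega>) t < \<infinity>" by (rule le_less_trans) simp
    qed
  qed
qed

text \<open>The exponential turns the sum over independent, identically distributed increments into
  2^n equal factors.\<close>

lemma nn_integral_exp_dyadic_variation:
  "(\<integral>\<^sup>+\<omega>. ennreal (exp (- dyadic_variation q (\<lambda>t. X t \<omega>) 1 n)) \<partial>M) =
    (\<integral>\<^sup>+y. ennreal (exp (- (\<bar>y\<bar> powr q))) \<partial>distr M borel (X (1 / 2 ^ n))) ^ 2 ^ n"
proof -
  let ?D = "\<lambda>i \<omega>. X (real (Suc i) / 2 ^ n) \<omega> - X (real i / 2 ^ n) \<omega>"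
  let ?e = "\<lambda>y. ennreal (exp (- (\<bar>y\<bar> powr q)))"
  have "indep_vars (\<lambda>_. borel) ?D {..<2 ^ n}"
    by (rule independent_increments) (auto simp: divide_strict_right_mono)
  hence indep: "indep_vars (\<lambda>_. borel) (\<lambda>i \<omega>. ?e (?D i \<omega>)) {..<2 ^ n}"
    by (rule indep_vars_compose2) auto
  have "(\<integral>\<^sup>+\<omega>. ennreal (exp (- dyadic_variation q (\<lambda>t. X t \<omega>) 1 n)) \<partial>M) =
      (\<integral>\<^sup>+\<omega>. (\<Prod>i<2 ^ n. ?e (?D i \<omega>)) \<partial>M)"
    unfolding dyadic_variation_def by (simp add: prod_ennreal exp_sum flip: sum_negf)
  also have "\<dots> = (\<Prod>i<2 ^ n. \<integral>\<^sup>+\<omega>. ?e (?D i \<omega>) \<partial>M)"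
    by (rule indep_vars_nn_integral[OF _ indep]) auto
  also have "\<dots> = (\<Prod>i<(2::nat) ^ n. \<integral>\<^sup>+y. ?e y \<partial>distr M borel (X (1 / 2 ^ n)))"
    by (intro prod.cong refl nn_integral_dyadic_increment[where f = ?e]) auto
  finally show ?thesis by simp
qed

text \<open>With v the mean of 1 - exp (- |y|^q) at level n, the mean of exp (- V_n) is (1 -
  v)^(2^n) <= exp (- 2^n v), and 2^n v reaches any B for suitable n. So the infimum of exp (- V_n)
  over all levels has mean zero and vanishes almost surely, which finite variation would
  exclude.\<close>

lemma AE_p_variation_infinite:
  assumes q: "0 < q" "q < 1" and inf: "(\<integral>\<^sup>+x\<in>{-1..1}. ennreal (\<bar>x\<bar> powr q) \<partial>F) = \<infinity>"
  shows "AE \<omega> in M. p_variation q (\<lambda>t. X t \<omega>) 1 = \<infinity>"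
proof -
  let ?V = "\<lambda>n \<omega>. dyadic_variation q (\<lambda>t. X t \<omega>) 1 n"
  have bound: "(\<integral>\<^sup>+\<omega>. (INF n. ennreal (exp (- ?V n \<omega>))) \<partial>M) \<le> ennreal (exp (- B))" if "0 \<le> B" for B
  proof -
    have lim: "(\<lambda>n. 1 / 2 ^ n :: real) \<longlonglongrightarrow> 0"
      using LIMSEQ_inverse_realpow_zero[of 2] by (simp add: inverse_eq_divide)
    have "\<forall>\<^sub>F n in sequentially. ennreal B < ennreal (1 / (1 / 2 ^ n)) *
      (\<integral>\<^sup>+y. ennreal (1 - exp (- (\<bar>y\<bar> powr q))) \<partial>distr M borel (X (1 / 2 ^ n)))"
      by (rule F.eventually_nn_integral_one_minus_exp_of_char[OF real_distribution_X char_X_dyadic _ lim q inf]) auto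
    then obtain n where n: "ennreal B < ennreal (2 ^ n) *
      (\<integral>\<^sup>+y. ennreal (1 - exp (- (\<bar>y\<bar> powr q))) \<partial>distr M borel (X (1 / 2 ^ n)))"
      using eventually_happens[of _ sequentially] by auto
    define \<mu> where "\<mu> = distr M borel (X (1 / 2 ^ n))"
    interpret \<mu>: real_distribution \<mu> unfolding \<mu>_def by (rule real_distribution_X) simp
    define v where "v = (\<integral>y. 1 - exp (- (\<bar>y\<bar> powr q)) \<partial>\<mu>)"
    have int: "integrable \<mu> (\<lambda>y. exp (- (\<bar>y\<bar> powr q)))"
      by (rule \<mu>.integrable_const_bound[where B = 1]) auto
    have v0: "0 \<le> v" unfolding v_def by (intro integral_nonneg_AE) auto
    have "(\<integral>\<^sup>+y. ennreal (1 - exp (- (\<bar>y\<bar> powr q))) \<partial>\<mu>) = ennreal v"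
      unfolding v_def by (intro nn_integral_eq_integral Bochner_Integration.integrable_diff int) auto
    hence "ennreal B < ennreal (2 ^ n * v)"
      using n v0 by (simp add: \<mu>_def ennreal_mult)
    hence B: "B \<le> 2 ^ n * v" using that v0 by (simp add: ennreal_less_iff)
    have "(\<integral>\<^sup>+y. ennreal (exp (- (\<bar>y\<bar> powr q))) \<partial>\<mu>) = ennreal (\<integral>y. exp (- (\<bar>y\<bar> powr q)) \<partial>\<mu>)"
      by (intro nn_integral_eq_integral int) auto
    also have "(\<integral>y. exp (- (\<bar>y\<bar> powr q)) \<partial>\<mu>) = 1 - v"
      unfolding v_def by (subst Bochner_Integration.integral_diff) (auto simp: int \<mu>.prob_space simp del: \<mu>.space_eq_univ)
    also have "ennreal (1 - v) \<le> ennreal (exp (- v))"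
      using exp_ge_add_one_self[of "- v"] by (intro ennreal_leI) simp
    finally have E: "(\<integral>\<^sup>+y. ennreal (exp (- (\<bar>y\<bar> powr q))) \<partial>\<mu>) \<le> ennreal (exp (- v))" .
    have "(\<integral>\<^sup>+\<omega>. (INF n. ennreal (exp (- ?V n \<omega>))) \<partial>M) \<le> (\<integral>\<^sup>+\<omega>. ennreal (exp (- ?V n \<omega>)) \<partial>M)"
      by (intro nn_integral_mono INF_lower) simp
    also have "\<dots> = (\<integral>\<^sup>+y. ennreal (exp (- (\<bar>y\<bar> powr q))) \<partial>\<mu>) ^ 2 ^ n"
      unfolding \<mu>_def by (rule nn_integral_exp_dyadic_variation)
    also have "\<dots> \<le> ennreal (exp (- v)) ^ 2 ^ n" using E by (intro power_mono) auto
    also have "\<dots> = ennreal (exp (- (2 ^ n * v)))"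
      by (simp add: ennreal_power flip: exp_of_nat_mult)
    also have "\<dots> \<le> ennreal (exp (- B))" using B by (intro ennreal_leI) simp
    finally show ?thesis .
  qed
  have "(\<integral>\<^sup>+\<omega>. (INF n. ennreal (exp (- ?V n \<omega>))) \<partial>M) \<le> 0"
  proof (rule LIMSEQ_le_const)
    have "(\<lambda>k. exp (- real k)) \<longlonglongrightarrow> 0"
      by (intro filterlim_compose[OF exp_at_bot] filterlim_compose[OF filterlim_uminus_at_bot_at_top] filterlim_real_sequentially)
    thus "(\<lambda>k. ennreal (exp (- real k))) \<longlonglongrightarrow> 0" using tendsto_ennrealI by fastforce
  qed (use bound in auto)
  hence "AE \<omega> in M. (INF n. ennreal (exp (- ?V n \<omega>))) = 0"
    by (subst nn_integral_0_iff_AE[symmetric]) auto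
  thus ?thesis
  proof eventually_elim
    case (elim \<omega>)
    show ?case
    proof (rule ccontr)
      assume "p_variation q (\<lambda>t. X t \<omega>) 1 \<noteq> \<infinity>"
      then obtain B where B: "p_variation q (\<lambda>t. X t \<omega>) 1 = ennreal B" "0 \<le> B"
        by (cases "p_variation q (\<lambda>t. X t \<omega>) 1") auto
      have "ennreal (exp (- B)) \<le> (INF n. ennreal (exp (- ?V n \<omega>)))"
      proof (intro INF_greatest ennreal_leI)
        fix n
        have "?V n \<omega> \<le> B"
          using dyadic_variation_le_p_variation[of q "\<lambda>t. X t \<omega>" n] B by simp
        thus "exp (- B) \<le> exp (- ?V n \<omega>)" by simp
      qed
      thus False using elim by simp
    qed
  qed
qed

end

section \<open>Tempered stable processes\<close>

lemma measurable_ts_density [measurable]: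
  "(\<lambda>x. ennreal (\<alpha>p / x powr (1 + \<beta>p) * exp (- lp * x) * indicator {0<..} x +
       \<alpha>m / \<bar>x\<bar> powr (1 + \<beta>m) * exp (- lm * \<bar>x\<bar>) * indicator {..<0} x)) \<in> borel_measurable borel"
  by measurable

lemma sets_ts_measure [measurable_cong, simp]: "sets (ts_measure \<alpha>p \<beta>p lp \<alpha>m \<beta>m lm) = sets borel"
  by (simp add: ts_measure_def)

text \<open>Evenness folds the negative half-line onto the positive one, leaving two one-sided
  integrals of the same shape.\<close>

lemma nn_integral_ts_measure:
  fixes g :: "real \<Rightarrow> ennreal"
  assumes [measurable]: "g \<in> borel_measurable borel" and even: "\<And>x. g (- x) = g x"
  shows "(\<integral>\<^sup>+x. g x \<partial>ts_measure \<alpha>p \<beta>p lp \<alpha>m \<beta>m lm) =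
    (\<integral>\<^sup>+x\<in>{0<..}. ennreal (\<alpha>p / x powr (1 + \<beta>p) * exp (- lp * x)) * g x \<partial>lborel) +
    (\<integral>\<^sup>+x\<in>{0<..}. ennreal (\<alpha>m / x powr (1 + \<beta>m) * exp (- lm * x)) * g x \<partial>lborel)"
  unfolding ts_measure_def
  by (subst nn_integral_density, simp, simp, subst nn_integral_lborel_split_sign, simp)
    (auto intro!: arg_cong2[of _ _ _ _ "(+)"] nn_integral_cong simp: indicator_def even)

lemma nn_integral_exp_1_inf:
  fixes l :: real
  assumes "0 < l"
  shows "(\<integral>\<^sup>+x\<in>{1..}. ennreal (exp (- l * x)) \<partial>lborel) < \<infinity>"
proof -
  have "((\<lambda>x. - exp (- l * x) / l) \<longlongrightarrow> - 0 / l) at_top"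
    using assms by (intro tendsto_intros filterlim_compose[OF exp_at_bot]
      filterlim_tendsto_neg_mult_at_bot[OF tendsto_const] filterlim_ident) auto
  hence "(\<integral>\<^sup>+x\<in>{1..}. ennreal (exp (- l * x)) \<partial>lborel) = ennreal (- 0 / l - (- exp (- l * 1) / l))"
    using assms by (intro nn_integral_FTC_atLeast) (auto intro!: derivative_eq_intros)
  thus ?thesis by simp
qed

text \<open>The integrand is \<alpha> x^(p-1-\<beta>) exp (- l x). The power is integrable at 0
  because \<beta> < p, and p <= 1 + \<beta> keeps it at most 1 for x >= 1, leaving the exponential
  tail.\<close>

lemma nn_integral_tempered_powr_finite:
  fixes p :: real
  assumes "0 < l" "\<beta> < p" "p \<le> 1 + \<beta>" "0 \<le> \<alpha>"
  shows "(\<integral>\<^sup>+x\<in>{0<..}. ennreal (\<alpha> / x powr (1 + \<beta>) * exp (- l * x)) * ennreal (\<bar>x\<bar> powr p) \<partial>lborel) < \<infinity>"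
proof -
  have "(\<integral>\<^sup>+x\<in>{0<..}. ennreal (\<alpha> / x powr (1 + \<beta>) * exp (- l * x)) * ennreal (\<bar>x\<bar> powr p) \<partial>lborel) \<le>
    (\<integral>\<^sup>+x. ennreal \<alpha> * (ennreal (x powr (p - 1 - \<beta>)) * indicator {0<..1} x) +
      ennreal \<alpha> * (ennreal (exp (- l * x)) * indicator {1..} x) \<partial>lborel)"
  proof (intro nn_integral_mono)
    fix x :: real
    have eq: "ennreal (\<alpha> / x powr (1 + \<beta>) * exp (- l * x)) * ennreal (\<bar>x\<bar> powr p) =
      ennreal \<alpha> * ennreal (x powr (p - 1 - \<beta>) * exp (- l * x))" if "0 < x"
    proof -
      have "x powr (p - 1 - \<beta>) = x powr p / x powr (1 + \<beta>)" using that by (simp add: diff_diff_eq powr_diff)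
      thus ?thesis using assms that by (simp add: mult_ac flip: ennreal_mult)
    qed
    have 1: "x powr (p - 1 - \<beta>) * exp (- l * x) \<le> x powr (p - 1 - \<beta>)" if "0 < x"
      using that assms by (intro mult_left_le) auto
    have 2: "x powr (p - 1 - \<beta>) * exp (- l * x) \<le> exp (- l * x)" if "1 < x"
      using that assms powr_mono[of "p - 1 - \<beta>" 0 x] by (intro mult_left_le_one_le) auto
    show "ennreal (\<alpha> / x powr (1 + \<beta>) * exp (- l * x)) * ennreal (\<bar>x\<bar> powr p) * indicator {0<..} x \<le>
      ennreal \<alpha> * (ennreal (x powr (p - 1 - \<beta>)) * indicator {0<..1} x) +
      ennreal \<alpha> * (ennreal (exp (- l * x)) * indicator {1..} x)"
    proof (cases "0 < x")
      case True
      show ?thesis unfolding eq[OF True]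
        using True 1 2 by (cases "x \<le> 1")
          (auto simp: indicator_def intro!: mult_left_mono ennreal_leI order_trans[OF _ add_increasing2])
    qed auto
  qed
  also have "\<dots> = ennreal \<alpha> * (\<integral>\<^sup>+x\<in>{0<..1}. ennreal (x powr (p - 1 - \<beta>)) \<partial>lborel) +
      ennreal \<alpha> * (\<integral>\<^sup>+x\<in>{1..}. ennreal (exp (- l * x)) \<partial>lborel)"
    by (subst nn_integral_add) (auto simp: nn_integral_cmult)
  also have "\<dots> < \<infinity>"
    using nn_integral_powr_0_1[of "p - 1 - \<beta>"] nn_integral_exp_1_inf[of l] assms
    by (auto simp: ennreal_mult_less_top)
  finally show ?thesis .
qed

text \<open>On (0, 1] the tempering factor is at least exp (- l), and the remaining exponent p - 1 -
  \<beta> is at most -1, even at the endpoint p = \<beta>.\<close>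

lemma nn_integral_tempered_powr_infinite:
  fixes p :: real
  assumes "0 < l" "p \<le> \<beta>" "0 < \<alpha>"
  shows "(\<integral>\<^sup>+x\<in>{0<..}. ennreal (\<alpha> / x powr (1 + \<beta>) * exp (- l * x)) *
    (ennreal (\<bar>x\<bar> powr p) * indicator {-1..1} x) \<partial>lborel) = \<infinity>"
proof -
  have "\<infinity> = ennreal (\<alpha> * exp (- l)) * (\<integral>\<^sup>+x\<in>{0<..1}. ennreal (x powr (p - 1 - \<beta>)) \<partial>lborel)"
    using assms by (subst nn_integral_powr_0_1_infinite) (auto simp: ennreal_mult_top)
  also have "\<dots> = (\<integral>\<^sup>+x. ennreal (\<alpha> * exp (- l)) * (ennreal (x powr (p - 1 - \<beta>)) * indicator {0<..1} x) \<partial>lborel)"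
    by (rule nn_integral_cmult[symmetric]) simp
  also have "\<dots> \<le> (\<integral>\<^sup>+x\<in>{0<..}. ennreal (\<alpha> / x powr (1 + \<beta>) * exp (- l * x)) *
    (ennreal (\<bar>x\<bar> powr p) * indicator {-1..1} x) \<partial>lborel)"
  proof (intro nn_integral_mono)
    fix x :: real
    have "ennreal (\<alpha> * exp (- l)) * ennreal (x powr (p - 1 - \<beta>)) \<le>
      ennreal (\<alpha> / x powr (1 + \<beta>) * exp (- l * x)) * ennreal (\<bar>x\<bar> powr p)" if "0 < x" "x \<le> 1"
    proof -
      have "x powr (p - 1 - \<beta>) = x powr p / x powr (1 + \<beta>)" using that by (simp add: diff_diff_eq powr_diff)
      hence "\<alpha> * exp (- l) * x powr (p - 1 - \<beta>) = (\<alpha> / x powr (1 + \<beta>) * exp (- l)) * x powr p" by simp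
      also have "\<dots> \<le> (\<alpha> / x powr (1 + \<beta>) * exp (- l * x)) * x powr p"
        using that assms by (intro mult_right_mono mult_left_mono) auto
      finally show ?thesis using assms that by (simp add: ennreal_leI flip: ennreal_mult)
    qed
    thus "ennreal (\<alpha> * exp (- l)) * (ennreal (x powr (p - 1 - \<beta>)) * indicator {0<..1} x) \<le>
      ennreal (\<alpha> / x powr (1 + \<beta>) * exp (- l * x)) *
      (ennreal (\<bar>x\<bar> powr p) * indicator {-1..1} x) * indicator {0<..} x"
      by (auto simp: indicator_def)
  qed
  finally show ?thesis by (simp add: top_unique)
qed

section \<open>Power moments and indices of the tempered stable Levy measure\<close>

context
  fixes \<alpha>p \<beta>p lp \<alpha>m \<beta>m lm :: real
  assumes pos: "0 < \<alpha>p" "0 < lp" "0 < \<alpha>m" "0 < lm"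
    and \<beta>: "0 \<le> \<beta>p" "\<beta>p < 1" "0 \<le> \<beta>m" "\<beta>m < 1"
begin

lemma nn_integral_powr_ts_measure_finite:
  assumes "max \<beta>p \<beta>m < p" "p < 1"
  shows "(\<integral>\<^sup>+x. ennreal (\<bar>x\<bar> powr p) \<partial>ts_measure \<alpha>p \<beta>p lp \<alpha>m \<beta>m lm) < \<infinity>"
  using nn_integral_tempered_powr_finite[of lp \<beta>p p \<alpha>p] nn_integral_tempered_powr_finite[of lm \<beta>m p \<alpha>m] assms pos \<beta>
  by (subst nn_integral_ts_measure) auto

lemma nn_integral_powr_ts_measure_infinite:
  assumes "p \<le> max \<beta>p \<beta>m"
  shows "(\<integral>\<^sup>+x\<in>{-1..1}. ennreal (\<bar>x\<bar> powr p) \<partial>ts_measure \<alpha>p \<beta>p lp \<alpha>m \<beta>m lm) = \<infinity>"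
proof -
  have "p \<le> \<beta>p \<or> p \<le> \<beta>m" using assms by auto
  thus ?thesis
    using nn_integral_tempered_powr_infinite[of lp p \<beta>p \<alpha>p] nn_integral_tempered_powr_infinite[of lm p \<beta>m \<alpha>m] pos
    by (subst nn_integral_ts_measure) (auto simp: indicator_def)
qed

lemma fv_levy_measure_ts_measure: "fv_levy_measure (ts_measure \<alpha>p \<beta>p lp \<alpha>m \<beta>m lm)"
proof -
  let ?F = "ts_measure \<alpha>p \<beta>p lp \<alpha>m \<beta>m lm"
  have "sigma_finite_measure ?F"
    unfolding ts_measure_def by (subst sigma_finite_measure.sigma_finite_iff_density_finite[OF lborel.sigma_finite_measure_axioms]) auto
  moreover have "(\<integral>\<^sup>+x. ennreal (min 1 \<bar>x\<bar>) \<partial>?F) < \<infinity>"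
  proof -
    \<comment> \<open>For p in (0, 1) the function min 1 |x| is at most |x|^p; such a p above both
      stability parameters exists because both are below 1.\<close>
    obtain p where p: "max \<beta>p \<beta>m < p" "p < 1" using dense[of "max \<beta>p \<beta>m" 1] \<beta> by auto
    hence p0: "0 < p" using \<beta> by simp
    have "min 1 \<bar>x\<bar> \<le> \<bar>x\<bar> powr p" for x :: real
    proof (cases "\<bar>x\<bar> \<le> 1")
      case True
      thus ?thesis using powr_mono'[of p 1 "\<bar>x\<bar>"] p by (cases "x = 0") auto
    next
      case False
      thus ?thesis using ge_one_powr_ge_zero[of "\<bar>x\<bar>" p] p0 by auto
    qed
    hence "(\<integral>\<^sup>+x. ennreal (min 1 \<bar>x\<bar>) \<partial>?F) \<le> (\<integral>\<^sup>+x. ennreal (\<bar>x\<bar> powr p) \<partial>?F)"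
      by (intro nn_integral_mono ennreal_leI) auto
    thus ?thesis using nn_integral_powr_ts_measure_finite[OF p] by (rule le_less_trans)
  qed
  ultimately show ?thesis by (simp add: fv_levy_measure_def fv_levy_measure_axioms_def)
qed

lemma emeasure_ts_measure_0: "emeasure (ts_measure \<alpha>p \<beta>p lp \<alpha>m \<beta>m lm) {0} = 0"
  unfolding ts_measure_def by (subst emeasure_density) (auto simp: nn_integral_0_iff_AE indicator_def)

lemma blumenthal_getoor_index_ts:
  assumes "levy_measure M X = ts_measure \<alpha>p \<beta>p lp \<alpha>m \<beta>m lm"
  shows "blumenthal_getoor_index M X = ereal (max \<beta>p \<beta>m)"
  unfolding blumenthal_getoor_index_def assms
proof (rule antisym)
  let ?F = "ts_measure \<alpha>p \<beta>p lp \<alpha>m \<beta>m lm"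
  let ?S = "{p. 0 < p \<and> (\<integral>\<^sup>+x\<in>{-1..1}. ennreal (\<bar>x\<bar> powr p) \<partial>?F) < \<infinity>}"
  have "max \<beta>p \<beta>m \<le> p" if "p \<in> ?S" for p
  proof (rule ccontr)
    assume "\<not> max \<beta>p \<beta>m \<le> p"
    thus False using that nn_integral_powr_ts_measure_infinite[of p] by auto
  qed
  thus "ereal (max \<beta>p \<beta>m) \<le> Inf (ereal ` ?S)" by (intro INF_greatest) auto
  show "Inf (ereal ` ?S) \<le> ereal (max \<beta>p \<beta>m)"
  \<comment> \<open>Only exponents between the maximum and 1 are tested; there the power moment over
    the whole line is already known to be finite.\<close>
  proof (rule dense_ge_bounded[where x = 1])
    show "ereal (max \<beta>p \<beta>m) < 1" using \<beta> by (simp add: one_ereal_def)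
    fix w assume w: "ereal (max \<beta>p \<beta>m) < w" "w < 1"
    then obtain p where p: "w = ereal p" "max \<beta>p \<beta>m < p" "p < 1" by (cases w) (auto simp: one_ereal_def)
    have "(\<integral>\<^sup>+x\<in>{-1..1}. ennreal (\<bar>x\<bar> powr p) \<partial>?F) \<le> (\<integral>\<^sup>+x. ennreal (\<bar>x\<bar> powr p) \<partial>?F)"
      by (intro nn_integral_mono) (auto simp: indicator_def)
    also have "\<dots> < \<infinity>" by (rule nn_integral_powr_ts_measure_finite) fact+
    finally have "p \<in> ?S" using p \<beta> by auto
    thus "Inf (ereal ` ?S) \<le> w" unfolding p(1) by (rule INF_lower)
  qed
qed

end

theorem proposition9p2:
  fixes \<alpha>p \<beta>p lp \<alpha>m \<beta>m lm :: real
    and M :: "'a measure" and X :: "real \<Rightarrow> 'a \<Rightarrow> real"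
  assumes "0 < \<alpha>p" and "0 < lp" and "0 < \<alpha>m" and "0 < lm"
    and "0 \<le> \<beta>p" and "\<beta>p < 1" and "0 \<le> \<beta>m" and "\<beta>m < 1"
    and "tempered_stable_process \<alpha>p \<beta>p lp \<alpha>m \<beta>m lm M X"
  shows "AE \<omega> in M. p_variation_index (\<lambda>t. X t \<omega>) = blumenthal_getoor_index M X \<and>
           blumenthal_getoor_index M X = ereal (max \<beta>p \<beta>m)"
proof -
  note ts = assms(1-8)
  define F where "F = ts_measure \<alpha>p \<beta>p lp \<alpha>m \<beta>m lm"
  have char: "char (distr M borel (X 1)) z = exp (fv_exponent F z)" for z
    using assms(9)
    unfolding tempered_stable_process_def tempered_stable_distribution_def F_def fv_exponent_def by blast
  interpret levy_process M X
    using assms(9) unfolding tempered_stable_process_def by blast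
  interpret F: fv_levy_measure F
    unfolding F_def using ts by (rule fv_levy_measure_ts_measure)
  interpret fv_levy_process M X F
    by unfold_locales (rule char)
  \<comment> \<open>\<open>levy_measure\<close> is a definite description, so the identification
    rests on existence together with uniqueness of the triplet.\<close>
  have "levy_measure M X = F"
    by (rule levy_measure_eqI, rule F.levy_khintchine_fv[OF _ char])
      (simp add: F_def emeasure_ts_measure_0[OF ts])
  hence BG: "blumenthal_getoor_index M X = ereal (max \<beta>p \<beta>m)"
    unfolding F_def by (rule blumenthal_getoor_index_ts[OF ts])
  define b where "b = max \<beta>p \<beta>m"
  have b: "0 \<le> b" "b < 1" using ts by (auto simp: b_def)
  \<comment> \<open>The offset 2 keeps (1 - b) / (k + 2) below 1 - b, so every \<open>p k\<close>
    lies strictly between b and 1. The \<open>q k\<close> lie below b and may be negative, as they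
    all are for b = 0; only positive ones carry a claim.\<close>
  define p where "p k = b + (1 - b) / real (k + 2)" for k
  define q where "q k = b - 1 / real (k + 2)" for k
  have p: "b < p k" "p k < 1" for k
  proof -
    have "(1 - b) * 1 < (1 - b) * real (k + 2)" using b by (intro mult_strict_left_mono) auto
    thus "b < p k" "p k < 1" using b by (auto simp: p_def field_simps)
  qed
  have q: "q k \<le> b" for k by (simp add: q_def)
  have lim: "(\<lambda>k. c / real (k + 2)) \<longlonglongrightarrow> 0" for c
    by (intro LIMSEQ_ignore_initial_segment lim_const_over_n)
  have p_lim: "p \<longlonglongrightarrow> b" unfolding p_def using tendsto_add[OF tendsto_const lim] by simp
  have q_lim: "q \<longlonglongrightarrow> b" unfolding q_def using tendsto_diff[OF tendsto_const lim] by simp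
  have "AE \<omega> in M. \<forall>k. \<forall>t\<ge>0. p_variation (p k) (\<lambda>t. X t \<omega>) t < \<infinity>"
    unfolding AE_all_countable
  proof
    fix k
    show "AE \<omega> in M. \<forall>t\<ge>0. p_variation (p k) (\<lambda>t. X t \<omega>) t < \<infinity>"
    proof (rule AE_p_variation_finite)
      show "(\<integral>\<^sup>+x. ennreal (\<bar>x\<bar> powr p k) \<partial>F) < \<infinity>"
        unfolding F_def using p[of k] by (intro nn_integral_powr_ts_measure_finite ts) (auto simp: b_def)
    qed (use p[of k] b in auto)
  qed
  moreover have "AE \<omega> in M. \<forall>k. 0 < q k \<longrightarrow> p_variation (q k) (\<lambda>t. X t \<omega>) 1 = \<infinity>"
    unfolding AE_all_countable
  proof
    fix k
    show "AE \<omega> in M. 0 < q k \<longrightarrow> p_variation (q k) (\<lambda>t. X t \<omega>) 1 = \<infinity>"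
    proof (cases "0 < q k")
      case True
      have "AE \<omega> in M. p_variation (q k) (\<lambda>t. X t \<omega>) 1 = \<infinity>"
      proof (rule AE_p_variation_infinite)
        show "(\<integral>\<^sup>+x\<in>{-1..1}. ennreal (\<bar>x\<bar> powr q k) \<partial>F) = \<infinity>"
          unfolding F_def using q[of k] by (intro nn_integral_powr_ts_measure_infinite ts) (auto simp: b_def)
      qed (use True q[of k] b in auto)
      thus ?thesis by simp
    qed simp
  qed
  ultimately show ?thesis
  proof eventually_elim
    case (elim \<omega>)
    have "0 < p k" for k using p(1)[of k] b(1) by linarith
    hence "p_variation_index (\<lambda>t. X t \<omega>) = ereal b"
      using elim by (intro p_variation_index_eqI[where p = p and q = q] p_lim q_lim) auto
    thus ?case using BG by (simp add: b_def)
  qed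
qed

end
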